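(* For every prime power $q$ and every integer $r\ge 0$, $$\lim_{g\to\infty}\alpha_q(g,r)=\frac{(q)_\infty}{(q^2)_\infty}\cdot\frac{1}{q^{r(r+1)/2}\,(q)_r}.$$ Thus, for every prime $p$, the distribution of elements of $\mathrm{Sp}_{2g}(p)$ according to the dimension $r$ of their eigenspace for the eigenvalue $1$ converges, as $g\to\infty$, to the case $u=0$ of the distribution $$r\mapsto \frac{(p^2)_u\,(p)_\infty}{(p)_u\,(p^2)_\infty}\cdot\frac{1}{p^{r(r+2u+1)/2}\,(p)_r}\qquad(r=0,1,2,\ldots).$$
   Context: For a prime power $q$ and integers $g,r\ge 0$, let $\mathrm{Sp}_{2g}(q)$ denote the symplectic group of dimension $2g$ over the finite field $\mathbb{F}_q$, acting naturally on $\mathbb{F}_q^{2g}$, and put $$\alpha_q(g,r):=\frac{|\{x\in \mathrm{Sp}_{2g}(q)\mid \dim_{\mathbb{F}_q}(\ker(x-\mathrm{id}))=r\}|}{|\mathrm{Sp}_{2g}(q)|}.$$ For an integer $m\ge 2$ and an integer $k\ge 0$ put $$(m)_k:=\prod_{i=1}^k(1-m^{-i}),\qquad (m)_\infty:=\prod_{i=1}^\infty(1-m^{-i}),$$ so $(m)_0=1$ and, for example, $(q^2)_\infty=\prod_{i\ge1}(1-q^{-2i})$. The displayed family of distributions, indexed by $u$, is the paper's conjectured distribution of $p$-ranks of relative class groups of number fields for unit rank $u$. *)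

theory Defs
  imports
    "Jordan_Normal_Form.Matrix_Kernel"
    "HOL-Analysis.Infinite_Products"
    "HOL-Number_Theory.Prime_Powers"
    "HOL-Library.Cardinality"
begin

text \<open>
  The field \<open>F\<^sub>q\<close> is a finite field type with \<open>q = CARD('a)\<close>. The group \<open>Sp\<^sub>2\<^sub>g(q)\<close> is the
  isometry group of the standard symplectic form \<open>(v, w) \<mapsto> v\<^sup>T J w\<close> on column vectors of
  length \<open>2g\<close>; the form is alternating in every characteristic, including 2. For \<open>g = 0\<close>
  the group consists of the empty matrix only.
\<close>

definition symplectic_form_mat :: "nat \<Rightarrow> 'a::field mat" where
  "symplectic_form_mat g =
     four_block_mat (0\<^sub>m g g) (1\<^sub>m g) (- 1\<^sub>m g) (0\<^sub>m g g)"

definition Sp :: "nat \<Rightarrow> 'a::field mat set" where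
  "Sp g = {x \<in> carrier_mat (2 * g) (2 * g).
             transpose_mat x * symplectic_form_mat g * x = symplectic_form_mat g}"

definition alpha :: "'a::{finite,field} itself \<Rightarrow> nat \<Rightarrow> nat \<Rightarrow> real" where
  "alpha _ g r =
     real (card {x \<in> (Sp g :: 'a mat set). kernel_dim (x - 1\<^sub>m (2 * g)) = r})
       / real (card (Sp g :: 'a mat set))"

definition qfac :: "nat \<Rightarrow> nat \<Rightarrow> real" where
  "qfac m k = (\<Prod>i=1..k. 1 - 1 / real m ^ i)"

definition qfac_inf :: "nat \<Rightarrow> real" where
  "qfac_inf m = (\<Prod>i. 1 - 1 / real m ^ Suc i)"

text \<open>
  The exponent \<open>r (r + 2u + 1)\<close> is always even, so the division on natural numbers is exact.
\<close>

definition class_group_rank_dist :: "nat \<Rightarrow> nat \<Rightarrow> nat \<Rightarrow> real" where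
  "class_group_rank_dist p u r =
     (qfac (p\<^sup>2) u * qfac_inf p) / (qfac p u * qfac_inf (p\<^sup>2))
       * (1 / (real p ^ (r * (r + 2 * u + 1) div 2) * qfac p r))"

end

theory Submission
  imports Defs
begin

text \<open>
  The proof is the method of moments, with the number of injective linear maps
  \<open>F\<^sub>q\<^sup>k \<rightarrow> ker (x - 1)\<close> as the \<open>k\<close>-th moment of an element \<open>x\<close> of the symplectic group. An injective
  map is the same as a list of \<open>k\<close> linearly independent vectors, so this moment is \<open>\<Prod>i<k. (q\<^sup>d - q\<^sup>i)\<close> with
  \<open>d = dim ker (x - 1)\<close>.

  By Burnside's counting argument, the average of the moment over \<open>Sp\<^sub>2\<^sub>g(q)\<close> is the number of orbits of the
  group on independent lists of length \<open>k\<close>. Witt's theorem (\<open>witt_extension\<close>) says that two such lists are in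
  the same orbit exactly if they have the same Gram matrix. The Gram matrix is alternating, so
  there are at most \<open>q\<close> to the power \<open>k choose 2\<close> orbits; and for \<open>k \<le> g\<close> every alternating matrix is the Gram
  matrix of an independent list, so that this bound is attained (\<open>alpha_moments\<close>).

  Hence each moment is eventually constant in \<open>g\<close>, and it is bounded uniformly in \<open>g\<close>. The indicator function
  of \<open>d = r\<close> is an explicit alternating combination of moments
  (\<open>injection_counts_separate_dimensions\<close>, a finite form of Euler's two product formulas). The
  weights of this combination, multiplied by the bounds on the moments, decay geometrically, so
  Tannery's theorem gives the limit of the distribution as a series. Euler's identity for
  \<open>\<Sum>j. z\<^sup>j / (q)\<^sub>j\<close> at \<open>z = -1/q\<close> evaluates that series
  (\<open>euler_series_minus_inverse\<close>). A second use of Tannery's theorem shows that no mass escapes to infinity.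

  Witt's theorem is obtained by counting. For an independent list \<open>xs\<close> in a space of dimension \<open>n\<close>, every
  system of equations \<open>form v (xs ! i) = b\<^sub>i\<close> has the same number of solutions \<open>v\<close>, because
  \<open>|W\<^sup>\<bottom>| \<cdot> |W| = q\<^sup>n\<close> for each subspace \<open>W\<close> (\<open>card_perp\<close>). The number of those solutions that lie in the
  span of \<open>xs\<close> can be read off the Gram matrix. So whenever one of two lists with equal Gram matrices can be
  extended in a prescribed way, the other one can be, too, up to a pair of bases with equal Gram matrices; the
  change of basis is the isometry sought.
\<close>

unbundle no vec_syntax
unbundle no inner_syntax
hide_type (open) Finite_Cartesian_Product.vec
hide_const (open) Finite_Cartesian_Product.vec

section \<open>The finite and infinite q-factorials and Euler's series\<close>

lemma qfac_0 [simp]: "qfac m 0 = 1"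
  by (simp add: qfac_def)

lemma qfac_Suc: "qfac m (Suc k) = qfac m k * (1 - 1 / real m ^ Suc k)"
  by (simp add: qfac_def)

lemma qfac_factor_pos:
  assumes "m \<ge> 2"
  shows "0 < 1 - 1 / real m ^ Suc k"
  using assms one_less_power[of "real m" "Suc k"] by (simp del: power_Suc)

lemma qfac_pos: "m \<ge> 2 \<Longrightarrow> qfac m k > 0"
  using qfac_factor_pos by (induction k) (simp_all add: qfac_Suc del: power_Suc)

lemma convergent_prod_qfac:
  assumes "m \<ge> 2"
  shows "convergent_prod (\<lambda>i. 1 - 1 / real m ^ Suc i)"
proof (rule abs_convergent_prod_imp_convergent_prod)
  have "summable (\<lambda>i. (1 / real m) ^ i)"
    using assms by (intro summable_geometric) simp
  hence "summable (\<lambda>i. (1 / real m) ^ Suc i)"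
    using summable_Suc_iff by blast
  thus "abs_convergent_prod (\<lambda>i. 1 - 1 / real m ^ Suc i)"
    unfolding abs_convergent_prod_conv_summable by (simp add: power_divide)
qed

lemma qfac_tendsto:
  assumes "m \<ge> 2"
  shows "qfac m \<longlonglongrightarrow> qfac_inf m"
proof -
  have "qfac m (Suc n) = (\<Prod>i\<le>n. 1 - 1 / real m ^ Suc i)" for n
    by (induction n) (simp_all add: qfac_Suc)
  hence "(\<lambda>n. qfac m (Suc n)) \<longlonglongrightarrow> qfac_inf m"
    using convergent_prod_LIMSEQ[OF convergent_prod_qfac[OF assms]]
    by (simp add: qfac_inf_def)
  thus ?thesis by (rule LIMSEQ_imp_Suc)
qed

lemma qfac_inf_pos:
  assumes "m \<ge> 2"
  shows "qfac_inf m > 0"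
proof -
  have "qfac_inf m \<noteq> 0"
    unfolding qfac_inf_def
    using qfac_factor_pos[OF assms]
    by (intro prodinf_nonzero convergent_prod_qfac assms) (metis less_irrefl)
  moreover have "qfac_inf m \<ge> 0"
    using qfac_tendsto[OF assms] qfac_pos[OF assms]
    by (intro LIMSEQ_le_const[OF qfac_tendsto[OF assms]]) (auto intro: less_imp_le)
  ultimately show ?thesis by simp
qed

lemma qfac_inf_le_qfac:
  assumes "m \<ge> 2"
  shows "qfac_inf m \<le> qfac m k"
proof (rule decseq_ge[OF _ qfac_tendsto[OF assms]])
  show "decseq (qfac m)"
    using assms by (intro decseq_SucI) (simp add: qfac_Suc mult_left_le qfac_pos less_imp_le)
qed

lemma qfac_square:
  "qfac (m\<^sup>2) k = qfac m k * (\<Prod>i=1..k. 1 + 1 / real m ^ i)"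
proof -
  have "1 - 1 / real (m\<^sup>2) ^ i = (1 - 1 / real m ^ i) * (1 + 1 / real m ^ i)" for i
  proof -
    have "real (m\<^sup>2) ^ i = real m ^ i * real m ^ i" by (simp add: power2_eq_square power_mult_distrib)
    thus ?thesis by (simp add: algebra_simps)
  qed
  thus ?thesis by (simp add: qfac_def prod.distrib)
qed

text \<open>
  By Euler this is \<open>1 / (\<Prod>i. 1 - z / m ^ i)\<close>, the product being over all \<open>i \<ge> 0\<close>; only its value at \<open>-1/m\<close>
  enters the limit law.
\<close>

definition euler_series :: "nat \<Rightarrow> real \<Rightarrow> real" where
  "euler_series m z = (\<Sum>j. z ^ j / qfac m j)"

lemma summable_euler_series:
  assumes "m \<ge> 2" "\<bar>z\<bar> < 1"
  shows "summable (\<lambda>j. \<bar>z\<bar> ^ j / qfac m j)" "summable (\<lambda>j. z ^ j / qfac m j)"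
proof -
  have "summable (\<lambda>j. \<bar>z\<bar> ^ j / qfac_inf m)"
    using assms by (intro summable_divide summable_geometric) simp
  thus 1: "summable (\<lambda>j. \<bar>z\<bar> ^ j / qfac m j)"
    using assms qfac_inf_pos[of m] qfac_pos[of m] qfac_inf_le_qfac[of m]
    by (elim summable_comparison_test') (auto simp: abs_mult less_imp_le intro!: divide_left_mono)
  show "summable (\<lambda>j. z ^ j / qfac m j)"
  proof (rule summable_norm_cancel)
    have "norm (z ^ j / qfac m j) = \<bar>z\<bar> ^ j / qfac m j" for j
      using qfac_pos[OF assms(1), of j] by (simp add: power_abs)
    thus "summable (\<lambda>j. norm (z ^ j / qfac m j))"
      using 1 by simp
  qed
qed

text \<open>
  Subtracting the two series termwise turns \<open>1 / qfac m j\<close> into \<open>1 / qfac m (j - 1)\<close>, which is a shift of the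
  series.
\<close>

lemma euler_series_functional_equation:
  assumes "m \<ge> 2" "\<bar>z\<bar> < 1"
  shows "euler_series m (z / m) = (1 - z) * euler_series m z"
proof -
  have z: "\<bar>z / m\<bar> < 1" using assms by (simp add: field_simps)
  note S = summable_euler_series(2)[OF assms] summable_euler_series(2)[OF assms(1) z]
  have eq: "z ^ Suc j / qfac m (Suc j) - (z / m) ^ Suc j / qfac m (Suc j) = z * (z ^ j / qfac m j)" for j
  proof -
    have "qfac m j \<noteq> 0" "1 - 1 / real m ^ Suc j \<noteq> 0"
      using qfac_pos[OF assms(1), of j] qfac_factor_pos[OF assms(1), of j] by auto
    hence "z ^ Suc j * (1 - 1 / real m ^ Suc j) / (qfac m j * (1 - 1 / real m ^ Suc j)) = z * (z ^ j / qfac m j)"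
      by simp
    thus ?thesis
      by (simp only: qfac_Suc power_divide) (simp add: diff_divide_distrib right_diff_distrib)
  qed
  have "euler_series m z - euler_series m (z / m) =
          (\<Sum>j. z ^ j / qfac m j - (z / m) ^ j / qfac m j)"
    unfolding euler_series_def using S by (rule suminf_diff)
  also have "\<dots> = (\<Sum>j. z ^ Suc j / qfac m (Suc j) - (z / m) ^ Suc j / qfac m (Suc j))"
    using S by (subst suminf_split_head) (auto intro: summable_diff)
  also have "\<dots> = z * euler_series m z"
    unfolding eq euler_series_def using S(1) by (rule suminf_mult)
  finally show ?thesis by (simp add: algebra_simps)
qed

lemma euler_series_tendsto_1:
  assumes "m \<ge> 2"
  shows "(euler_series m \<longlongrightarrow> 1) (at 0)"
proof -
  have "isCont (\<lambda>z. \<Sum>j. (1 / qfac m j) * z ^ j) 0"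
    using summable_euler_series(2)[OF assms, of "1/2"]
    by (intro isCont_powser[of _ "1/2"]) simp_all
  moreover have "euler_series m = (\<lambda>z. \<Sum>j. (1 / qfac m j) * z ^ j)"
    by (simp add: euler_series_def fun_eq_iff)
  moreover have "euler_series m 0 = 1"
    unfolding euler_series_def by (subst suminf_finite[of "{0}"]) (auto simp: power_0_left)
  ultimately show ?thesis by (simp add: isCont_def)
qed

text \<open>
  Iterating the functional equation from \<open>z = -1/m\<close> pushes the argument to \<open>0\<close>, where the series is
  \<open>1\<close>, at the cost of the factors \<open>1 + 1/m\<^sup>i\<close>. Their product is a quotient of q-factorials
  because of \<open>1 - x\<^sup>2 = (1 - x) (1 + x)\<close>.
\<close>

theorem euler_series_minus_inverse:
  assumes "m \<ge> 2"
  shows "euler_series m (- 1 / m) = qfac_inf m / qfac_inf (m\<^sup>2)"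
proof -
  have m2: "m\<^sup>2 \<ge> 2" using assms power_increasing[of 1 2 m] by simp
  have m4: "\<bar>- 1 / real m ^ Suc n\<bar> < 1" for n
    using qfac_factor_pos[OF assms, of n] by simp
  have prod: "euler_series m (- 1 / real m ^ Suc n) =
      (\<Prod>i=1..n. 1 + 1 / real m ^ i) * euler_series m (- 1 / m)" for n
  proof (induction n)
    case (Suc n)
    have "euler_series m (- 1 / real m ^ Suc (Suc n)) = euler_series m ((- 1 / real m ^ Suc n) / m)"
      by (simp add: field_simps)
    also have "\<dots> = (1 + 1 / real m ^ Suc n) * euler_series m (- 1 / real m ^ Suc n)"
      using euler_series_functional_equation[OF assms m4[of n]] by simp
    finally show ?case unfolding Suc by (simp add: mult_ac)
  qed simp
  have "filterlim (\<lambda>n. - 1 / real m ^ Suc n) (at 0) sequentially"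
  proof (rule filterlim_atI)
    have "(\<lambda>n. - ((1 / real m) ^ Suc n)) \<longlonglongrightarrow> - 0"
      using assms by (intro tendsto_minus LIMSEQ_Suc LIMSEQ_power_zero) simp
    thus "(\<lambda>n. - 1 / real m ^ Suc n) \<longlonglongrightarrow> 0" by (simp add: power_divide)
  qed (use assms in auto)
  hence "(\<lambda>n. euler_series m (- 1 / real m ^ Suc n)) \<longlonglongrightarrow> 1"
    by (rule filterlim_compose[OF euler_series_tendsto_1[OF assms]])
  hence "(\<lambda>n. euler_series m (- 1 / real m ^ Suc n) * (qfac m n / qfac (m\<^sup>2) n)) \<longlonglongrightarrow>
          1 * (qfac_inf m / qfac_inf (m\<^sup>2))"
    using qfac_inf_pos[OF m2] by (intro tendsto_intros qfac_tendsto assms m2) auto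
  moreover have "euler_series m (- 1 / real m ^ Suc n) * (qfac m n / qfac (m\<^sup>2) n) =
      euler_series m (- 1 / m)" for n
  proof -
    have "qfac (m\<^sup>2) n \<noteq> 0" using qfac_pos[OF m2, of n] by simp
    thus ?thesis unfolding prod by (simp add: qfac_square)
  qed
  ultimately show ?thesis
    by (simp add: LIMSEQ_const_iff)
qed

section \<open>Recovering a distribution from its injection moments\<close>

lemma choose_two_Suc: "Suc k choose 2 = k + (k choose 2)"
  by (simp add: numeral_2_eq_2)

lemma qfac_div_step:
  assumes "m \<ge> 2"
  shows "(1 - 1 / real m ^ Suc k) / qfac m (Suc k) = 1 / qfac m k"
proof -
  have "1 - 1 / real m ^ Suc k \<noteq> 0"
    using qfac_factor_pos[OF assms, of k] by linarith
  thus ?thesis by (simp only: qfac_Suc) (simp add: divide_simps)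
qed

text \<open>
  Euler's two expansions, of \<open>\<Prod>(1 + z / m\<^sup>i)\<close> and of \<open>1 / \<Prod>(1 + z / m\<^sup>i)\<close>, are inverse power series in \<open>z\<close>, and
  this is the coefficient of \<open>z\<^sup>n\<close> in their product. The proof stays with the coefficients: both
  sequences satisfy a first-order recursion with the factor \<open>1 - 1/m\<^sup>i\<close>, and
  \<open>1 - s t = (1 - s) + s (1 - t)\<close> distributes the factor \<open>1 - 1/m\<^sup>n\<close> over the two sides of the convolution,
  after which the two resulting sums cancel.
\<close>

lemma euler_coefficients_orthogonal:
  assumes m: "m \<ge> 2"
  shows "(\<Sum>i\<le>n. (-1) ^ (n - i) / (real m ^ (i choose 2) * qfac m i * qfac m (n - i)))
           = (if n = 0 then 1 else 0)"
proof (cases n)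
  case (Suc n')
  define a b where "a i = 1 / (real m ^ (i choose 2) * qfac m i)"
    and "b i = (-1) ^ i / qfac m i" for i
  have a: "(1 - 1 / real m ^ Suc i) * a (Suc i) = a i / real m ^ i" for i
  proof -
    have "(1 - 1 / real m ^ Suc i) * a (Suc i) =
      ((1 - 1 / real m ^ Suc i) / qfac m (Suc i)) * (1 / real m ^ (Suc i choose 2))"
      by (simp add: a_def)
    thus ?thesis by (simp only: qfac_div_step[OF m] choose_two_Suc) (simp add: a_def power_add)
  qed
  have b: "(1 - 1 / real m ^ Suc i) * b (Suc i) = - b i" for i
  proof -
    have "(1 - 1 / real m ^ Suc i) * b (Suc i) =
      ((1 - 1 / real m ^ Suc i) / qfac m (Suc i)) * (-1) ^ Suc i"
      by (simp add: b_def)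
    thus ?thesis by (simp only: qfac_div_step[OF m]) (simp add: b_def)
  qed
  have "(1 - 1 / real m ^ n) * (\<Sum>i\<le>n. a i * b (n - i)) =
     (\<Sum>i\<le>n. (1 - 1 / real m ^ i) * a i * b (n - i))
     + (\<Sum>i\<le>n. a i / real m ^ i * ((1 - 1 / real m ^ (n - i)) * b (n - i)))"
    unfolding sum_distrib_left sum.distrib[symmetric]
  proof (rule sum.cong)
    fix i assume "i \<in> {..n}"
    hence "real m ^ n = real m ^ i * real m ^ (n - i)" by (simp flip: power_add)
    thus "(1 - 1 / real m ^ n) * (a i * b (n - i)) = (1 - 1 / real m ^ i) * a i * b (n - i)
       + a i / real m ^ i * ((1 - 1 / real m ^ (n - i)) * b (n - i))"
      by (simp add: algebra_simps)
  qed simp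
  also have "(\<Sum>i\<le>n. (1 - 1 / real m ^ i) * a i * b (n - i)) = (\<Sum>i\<le>n'. a i / real m ^ i * b (n' - i))"
    unfolding Suc by (subst sum.atMost_Suc_shift) (simp only: a diff_Suc_Suc, simp)
  also have "(\<Sum>i\<le>n. a i / real m ^ i * ((1 - 1 / real m ^ (n - i)) * b (n - i)))
      = (\<Sum>i\<le>n'. a i / real m ^ i * (- b (n' - i))) + 0"
    unfolding Suc sum.atMost_Suc
  proof (rule arg_cong2[of _ _ _ _ "(+)"], rule sum.cong)
    fix i assume "i \<in> {..n'}"
    hence "Suc n' - i = Suc (n' - i)" by (simp add: Suc_diff_le)
    thus "a i / real m ^ i * ((1 - 1 / real m ^ (Suc n' - i)) * b (Suc n' - i))
        = a i / real m ^ i * (- b (n' - i))"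
      by (simp only: b)
  qed simp_all
  finally have "(1 - 1 / real m ^ n) * (\<Sum>i\<le>n. a i * b (n - i)) = 0"
    by (simp add: sum_negf)
  moreover have "1 - 1 / real m ^ n \<noteq> 0"
    unfolding Suc using qfac_factor_pos[OF m, of n'] by linarith
  ultimately have "(\<Sum>i\<le>n. a i * b (n - i)) = 0" by (metis mult_eq_0_iff)
  moreover have "n \<noteq> 0" by (simp add: Suc)
  ultimately show ?thesis by (simp add: a_def b_def)
qed (simp add: numeral_2_eq_2)

lemma prod_power_diff:
  assumes "m \<ge> 2" "k \<le> d"
  shows "(\<Prod>i<k. real m ^ d - real m ^ i) = real m ^ (d * k) * qfac m d / qfac m (d - k)"
  using \<open>k \<le> d\<close>
proof (induction k)
  case 0
  thus ?case using qfac_pos[OF assms(1), of d] by simp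
next
  case (Suc k)
  then obtain e where d: "d = Suc e + k" by (metis add.commute le_iff_add add_Suc_shift)
  define w where "w = 1 - 1 / real m ^ Suc e"
  have "real m ^ d - real m ^ k = real m ^ d * w"
    using assms(1) by (simp add: w_def d power_add field_simps)
  moreover have "qfac m (d - k) = qfac m (d - Suc k) * w"
    by (simp add: d w_def qfac_Suc)
  moreover have "w > 0"
    unfolding w_def using qfac_factor_pos[OF assms(1)] .
  ultimately show ?case using Suc by (simp add: power_add)
qed

lemma prod_power_diff_eq_0: "d < k \<Longrightarrow> (\<Prod>i<k. real m ^ d - real m ^ i) = 0"
  by (auto intro!: prod_zero)

text \<open>
  Moebius inversion on the lattice of subspaces gives the weight \<open>(-1)\<^sup>j * m ^ (j choose 2)\<close> to a subspace of
  dimension \<open>r\<close> inside one of dimension \<open>r + j\<close>. The coefficient is that weight, times the number of such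
  subspaces, divided by the number of bases of the larger space.
\<close>

definition inversion_coeff :: "nat \<Rightarrow> nat \<Rightarrow> nat \<Rightarrow> real" where
  "inversion_coeff m r j =
     (-1) ^ j / (real m ^ ((Suc r choose 2) + (r + j choose 2) + j) * qfac m r * qfac m j)"

text \<open>
  This is where the quadratic exponents meet: with \<open>k = r + j\<close> and \<open>d = k + i\<close>, the power \<open>d * k\<close> of the
  \<open>k\<close>-th moment is traded for a term in \<open>i = d - k\<close> and terms that depend on \<open>k\<close> or \<open>d\<close> alone.
\<close>

lemma inversion_exponents:
  "(k + i) * k + (i choose 2) + i = (k choose 2) + (Suc (k + i) choose 2)"
  by (induction k) (simp_all add: choose_two_Suc)

text \<open>
  Moebius inversion on subspaces: a space of dimension \<open>d > r\<close> is counted through all its subspaces with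
  alternating signs, and the contributions cancel by \<open>euler_coefficients_orthogonal\<close> with \<open>n = d - r\<close>.
\<close>

lemma injection_counts_separate_dimensions:
  assumes m: "m \<ge> 2" and "d \<le> K"
  shows "(\<Sum>j\<le>K. inversion_coeff m r j * (\<Prod>i<r+j. real m ^ d - real m ^ i)) = (if d = r then 1 else 0)"
proof (cases "r \<le> d")
  case False
  thus ?thesis by (auto intro!: sum.neutral simp: prod_power_diff_eq_0)
next
  case True
  define n where "n = d - r"
  have d: "d = r + n" using True by (simp add: n_def)
  define C where "C = real m ^ (Suc d choose 2) * qfac m d / (real m ^ ((Suc r choose 2) + n) * qfac m r)"
  have m0: "real m \<noteq> 0" using m by simp
  have "(\<Sum>j\<le>K. inversion_coeff m r j * (\<Prod>i<r+j. real m ^ d - real m ^ i)) =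
        (\<Sum>j\<le>n. inversion_coeff m r j * (\<Prod>i<r+j. real m ^ d - real m ^ i))"
    using assms(2) d by (intro sum.mono_neutral_right) (auto simp: prod_power_diff_eq_0)
  also have "\<dots> = (\<Sum>j\<le>n. C * ((-1) ^ j / (real m ^ (n - j choose 2) * qfac m (n - j) * qfac m j)))"
  proof (rule sum.cong)
    fix j assume "j \<in> {..n}"
    then obtain i where n: "n = j + i" by (auto simp: le_iff_add)
    have "d * (r + j) + (i choose 2) + n = (r + j choose 2) + (Suc d choose 2) + j"
      using inversion_exponents[of "r + j" i] by (simp add: d n add_ac)
    hence "real m ^ (d * (r + j)) * real m ^ (i choose 2) * real m ^ n =
          real m ^ (r + j choose 2) * real m ^ (Suc d choose 2) * real m ^ j"
      by (simp flip: power_add)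
    hence "real m ^ (d * (r + j)) = real m ^ (r + j choose 2) * real m ^ (Suc d choose 2) * real m ^ j
        / (real m ^ (i choose 2) * real m ^ n)"
      using m0 by (simp add: field_simps)
    moreover have "d - (r + j) = i" "n - j = i" "r + j \<le> d" by (auto simp: d n)
    ultimately show "inversion_coeff m r j * (\<Prod>i<r+j. real m ^ d - real m ^ i) =
      C * ((-1) ^ j / (real m ^ (n - j choose 2) * qfac m (n - j) * qfac m j))"
      using m0 by (simp add: prod_power_diff[OF m] inversion_coeff_def C_def power_add ac_simps)
  qed simp
  also have "\<dots> = C * (\<Sum>j\<le>n. (-1) ^ (n - j) / (real m ^ (j choose 2) * qfac m j * qfac m (n - j)))"
    unfolding sum_distrib_left[symmetric]
    by (rule arg_cong[of _ _ "(*) C"], rule sum.reindex_bij_witness[of _ "\<lambda>j. n - j" "\<lambda>j. n - j"]) (auto simp: mult_ac)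
  also have "\<dots> = (if d = r then 1 else 0)"
    using m0 qfac_pos[OF m, of r] by (simp add: euler_coefficients_orthogonal[OF m] d) (simp add: C_def d)
  finally show ?thesis .
qed

text \<open>
  The limiting moments cancel the quadratic exponents of the inversion weights, and a term of Euler's
  series at \<open>-1/m\<close> remains. Its geometric decay is what makes the exchange of limit and sum possible.
\<close>

lemma inversion_coeff_times_moment:
  assumes "m \<ge> 2"
  shows "inversion_coeff m r j * real m ^ (r + j choose 2)
     = 1 / (real m ^ (Suc r choose 2) * qfac m r) * ((- 1 / m) ^ j / qfac m j)"
  using assms by (simp add: inversion_coeff_def power_add power_divide power_minus[of "1 / real m"])

text \<open>
  In binomial form the exponent obeys the recursion \<open>choose_two_Suc\<close> without divisions.
\<close>

lemma class_group_rank_dist_0: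
  "class_group_rank_dist m 0 r =
     qfac_inf m / qfac_inf (m\<^sup>2) * (1 / (real m ^ (Suc r choose 2) * qfac m r))"
  by (simp add: class_group_rank_dist_def choose_two mult.commute)

text \<open>
  Here \<open>p g\<close> is a distribution on \<open>{..D g}\<close> and \<open>N g k\<close> its \<open>k\<close>-th injection moment. Since
  \<open>N g 0\<close> is the total mass, the assumption on \<open>N\<close> also makes \<open>p g\<close> a probability distribution for large \<open>g\<close>.
\<close>

theorem convergence_from_injection_moments:
  fixes p N :: "nat \<Rightarrow> nat \<Rightarrow> real" and D :: "nat \<Rightarrow> nat"
  assumes m: "m \<ge> 2"
    and p_nonneg: "\<And>g r. 0 \<le> p g r"
    and p_zero: "\<And>g r. D g < r \<Longrightarrow> p g r = 0"
    and moment: "\<And>g k. (\<Sum>r\<le>D g. p g r * (\<Prod>i<k. real m ^ r - real m ^ i)) = N g k"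
    and N_nonneg: "\<And>g k. 0 \<le> N g k"
    and N_le: "\<And>g k. N g k \<le> real m ^ (k choose 2)"
    and N_eq: "\<And>k. eventually (\<lambda>g. N g k = real m ^ (k choose 2)) sequentially"
  shows "(\<lambda>g. p g r) \<longlonglongrightarrow> class_group_rank_dist m 0 r" and "class_group_rank_dist m 0 sums 1"
proof -
  have p_conv: "(\<lambda>g. p g r) \<longlonglongrightarrow> class_group_rank_dist m 0 r" for r
  proof -
    define c where "c = 1 / (real m ^ (Suc r choose 2) * qfac m r)"
    have c: "c > 0" using m qfac_pos[OF m, of r] by (simp add: c_def)
    have N_zero: "N g k = 0" if "D g < k" for g k
      using that by (auto simp: prod_power_diff_eq_0 simp flip: moment intro!: sum.neutral)
    \<comment> \<open>The sum is finite, as moments of order above \<open>D g\<close> vanish; so the inversion formula can be applied pointwise.\<close>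
    have p_eq: "p g r = (\<Sum>j. inversion_coeff m r j * N g (r + j))" for g
    proof -
      have "(\<Sum>j. inversion_coeff m r j * N g (r + j)) = (\<Sum>j\<le>D g. inversion_coeff m r j * N g (r + j))"
        by (rule suminf_finite) (auto simp: N_zero)
      also have "\<dots> = (\<Sum>d\<le>D g. p g d * (\<Sum>j\<le>D g. inversion_coeff m r j * (\<Prod>i<r+j. real m ^ d - real m ^ i)))"
        unfolding moment[symmetric] sum_distrib_left
        by (subst sum.swap) (simp add: mult_ac)
      also have "\<dots> = (\<Sum>d\<le>D g. if d = r then p g d else 0)"
        by (intro sum.cong refl) (simp add: injection_counts_separate_dimensions[OF m])
      also have "\<dots> = p g r" using p_zero[of g r] by simp
      finally show ?thesis by simp
    qed
    have "(\<lambda>g. \<Sum>j. inversion_coeff m r j * N g (r + j)) \<longlonglongrightarrow> (\<Sum>j. c * ((- 1 / m) ^ j / qfac m j))"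
    proof (rule tannerys_theorem[THEN conjunct2, THEN conjunct2])
      show "(\<lambda>g. inversion_coeff m r j * N g (r + j)) \<longlonglongrightarrow> c * ((- 1 / m) ^ j / qfac m j)" for j
        using N_eq[of "r + j"] unfolding c_def inversion_coeff_times_moment[OF m, symmetric]
        by (intro tendsto_mult_left tendsto_eventually)
      show "summable (\<lambda>j. c * (\<bar>- 1 / real m\<bar> ^ j / qfac m j))"
        using m by (intro summable_mult summable_euler_series(1)) simp_all
      have "norm (inversion_coeff m r j * N g (r + j)) \<le> c * (\<bar>- 1 / real m\<bar> ^ j / qfac m j)" for j g
      proof -
        have "norm (inversion_coeff m r j * N g (r + j)) \<le> \<bar>inversion_coeff m r j * real m ^ (r + j choose 2)\<bar>"
          using N_nonneg[of g "r + j"] N_le[of g "r + j"] by (simp add: abs_mult mult_left_mono)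
        also have "\<dots> = c * (\<bar>- 1 / real m\<bar> ^ j / qfac m j)"
          unfolding inversion_coeff_times_moment[OF m] using c qfac_pos[OF m, of j] qfac_pos[OF m, of r]
          by (simp add: c_def abs_mult power_abs)
        finally show ?thesis .
      qed
      thus "\<forall>\<^sub>F (j, g) in sequentially \<times>\<^sub>F sequentially.
         norm (inversion_coeff m r j * N g (r + j)) \<le> c * (\<bar>- 1 / real m\<bar> ^ j / qfac m j)"
        by (intro always_eventually) auto
    qed simp
    also have "(\<Sum>j. c * ((- 1 / m) ^ j / qfac m j)) = c * euler_series m (- 1 / m)"
      unfolding euler_series_def using m by (intro suminf_mult summable_euler_series(2)) simp_all
    also have "\<dots> = class_group_rank_dist m 0 r"
      unfolding euler_series_minus_inverse[OF m] by (simp add: class_group_rank_dist_0 c_def)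
    finally show ?thesis by (simp only: p_eq[symmetric])
  qed
  show "(\<lambda>g. p g r) \<longlonglongrightarrow> class_group_rank_dist m 0 r" by (rule p_conv)

  define B where "B r = (1 / real m) ^ r / qfac m r" for r
  \<comment> \<open>A space of dimension \<open>r\<close> has \<open>qfac m r * m\<^bsup>r * r\<^esup>\<close> bases, so the \<open>r\<close>-th moment alone bounds \<open>p g r\<close>.\<close>
  have p_le: "norm (p g r) \<le> B r" for g r
  proof (cases "r \<le> D g")
    case True
    have "p g r * (\<Prod>i<r. real m ^ r - real m ^ i) \<le> (\<Sum>d\<le>D g. p g d * (\<Prod>i<r. real m ^ d - real m ^ i))"
    proof (rule member_le_sum)
      fix d
      show "0 \<le> p g d * (\<Prod>i<r. real m ^ d - real m ^ i)"
      proof (cases "d < r")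
        case False
        hence "real m ^ i \<le> real m ^ d" if "i < r" for i
          using that m by (intro power_increasing) auto
        thus ?thesis using p_nonneg by (intro mult_nonneg_nonneg prod_nonneg) auto
      qed (simp add: prod_power_diff_eq_0)
    qed (use True in auto)
    also have "\<dots> \<le> real m ^ (r choose 2)" unfolding moment by (rule N_le)
    finally have "p g r * (real m ^ (r * r) * qfac m r) \<le> real m ^ (r choose 2)"
      by (simp add: prod_power_diff[OF m])
    moreover have "r * r = (r choose 2) + (Suc r choose 2)"
      using inversion_exponents[of r 0] by (simp add: numeral_2_eq_2)
    ultimately have "p g r * (real m ^ (Suc r choose 2) * qfac m r) * real m ^ (r choose 2) \<le> real m ^ (r choose 2)"
      by (simp add: power_add mult_ac)
    hence "p g r * (real m ^ (Suc r choose 2) * qfac m r) \<le> 1" using m by simp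
    moreover have "p g r * (real m ^ r * qfac m r) \<le> p g r * (real m ^ (Suc r choose 2) * qfac m r)"
      using m p_nonneg qfac_pos[OF m, of r]
      by (intro mult_left_mono mult_right_mono power_increasing) (auto simp: choose_two_Suc)
    ultimately have "p g r * (real m ^ r * qfac m r) \<le> 1" by linarith
    thus ?thesis using m p_nonneg qfac_pos[OF m, of r] by (simp add: B_def field_simps)
  qed (use p_zero m qfac_pos[OF m, of r] in \<open>simp add: B_def\<close>)
  have T: "eventually (\<lambda>g. summable (\<lambda>r. norm (p g r))) sequentially \<and>
      summable (\<lambda>r. norm (class_group_rank_dist m 0 r)) \<and> ((\<lambda>g. \<Sum>r. p g r) \<longlonglongrightarrow> (\<Sum>r. class_group_rank_dist m 0 r))"
  proof (rule tannerys_theorem[where M = B])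
    show "summable B" unfolding B_def
      using summable_euler_series(1)[OF m, of "1 / m"] m by simp
  qed (use p_conv p_le in \<open>auto intro: always_eventually\<close>)
  have "(\<Sum>r. p g r) = N g 0" for g
  proof -
    have "(\<Sum>r. p g r) = (\<Sum>r\<le>D g. p g r)" by (rule suminf_finite) (auto simp: p_zero)
    thus ?thesis by (simp flip: moment)
  qed
  moreover have "(\<lambda>g. N g 0) \<longlonglongrightarrow> 1"
    using N_eq[of 0] by (intro tendsto_eventually) (simp add: numeral_2_eq_2)
  ultimately have "(\<Sum>r. class_group_rank_dist m 0 r) = 1"
    using T LIMSEQ_unique by fastforce
  moreover have "summable (class_group_rank_dist m 0)" using T summable_norm_cancel by blast
  ultimately show "class_group_rank_dist m 0 sums 1" by (simp add: sums_iff)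
qed

section \<open>Linear independence of lists and counting over a finite field\<close>

lemma finite_lists_length: "finite {cs :: 'a::finite list. length cs = k}"
  using finite_lists_length_eq[where A = "UNIV :: 'a set" and n = k, OF finite]
  by (simp only: subset_UNIV simp_thms)

lemma card_lists_length: "card {cs :: 'a::finite list. length cs = k} = CARD('a) ^ k"
  using card_lists_length_eq[where A = "UNIV :: 'a set" and n = k, OF finite]
  by (simp only: subset_UNIV simp_thms)

lemma bij_betw_list_of_vec: "bij_betw vec_of_list {cs :: 'a list. length cs = n} (carrier_vec n)"
proof (rule bij_betw_byWitness[where f' = list_of_vec])
  show "\<forall>cs\<in>{cs. length cs = n}. list_of_vec (vec_of_list cs :: 'a vec) = cs"
    by (simp only: list_vec Ball_def simp_thms)
  show "\<forall>v\<in>carrier_vec n. vec_of_list (list_of_vec (v :: 'a vec)) = v"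
    by (simp only: vec_list Ball_def simp_thms)
  show "(vec_of_list :: 'a list \<Rightarrow> 'a vec) ` {cs. length cs = n} \<subseteq> carrier_vec n"
    by (rule image_subsetI) (simp only: mem_Collect_eq carrier_vec_def dim_vec_of_list)
  show "list_of_vec ` (carrier_vec n :: 'a vec set) \<subseteq> {cs. length cs = n}"
    by (rule image_subsetI) (simp only: mem_Collect_eq carrier_vec_def length_list_of_vec)
qed

lemma finite_vectors [simp]: "finite (carrier_vec n :: 'a::finite vec set)"
  using bij_betw_finite[OF bij_betw_list_of_vec[where 'a = 'a and n = n]]
  by (simp add: finite_lists_length)

lemma card_vectors: "card (carrier_vec n :: 'a::finite vec set) = CARD('a) ^ n"
  using bij_betw_same_card[OF bij_betw_list_of_vec[where 'a = 'a and n = n]]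
  by (simp add: card_lists_length)

lemma finite_matrices [simp]: "finite (carrier_mat n m :: 'a::finite mat set)"
proof (rule finite_imageD[where f = "\<lambda>A. map (col A) [0..<m]"])
  have "(\<lambda>A. map (col A) [0..<m]) ` (carrier_mat n m :: 'a mat set)
      \<subseteq> {vs. set vs \<subseteq> carrier_vec n \<and> length vs = m}"
    by (auto intro: col_carrier_vec)
  thus "finite ((\<lambda>A. map (col A) [0..<m]) ` (carrier_mat n m :: 'a mat set))"
    by (rule finite_subset) (rule finite_lists_length_eq, simp)
  show "inj_on (\<lambda>A. map (col A) [0..<m]) (carrier_mat n m :: 'a mat set)"
  proof (rule inj_onI)
    fix A B :: "'a mat"
    assume A: "A \<in> carrier_mat n m" and B: "B \<in> carrier_mat n m"
      and eq: "map (col A) [0..<m] = map (col B) [0..<m]"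
    show "A = B"
      using A B eq by (intro mat_col_eqI) (simp_all add: map_eq_conv)
  qed
qed

fun lin_comb :: "nat \<Rightarrow> 'a::field list \<Rightarrow> 'a vec list \<Rightarrow> 'a vec" where
  "lin_comb n (c # cs) (v # vs) = c \<cdot>\<^sub>v v + lin_comb n cs vs"
| "lin_comb n _ _ = 0\<^sub>v n"

definition list_span :: "nat \<Rightarrow> 'a::field vec list \<Rightarrow> 'a vec set" where
  "list_span n vs = {lin_comb n cs vs | cs. length cs = length vs}"

text \<open>
  Recursive on lists: adding a vector outside the span is the step in which independent
  lists are counted and extended below.
\<close>

fun indep :: "nat \<Rightarrow> 'a::field vec list \<Rightarrow> bool" where
  "indep n [] = True"
| "indep n (v # vs) = (v \<in> carrier_vec n - list_span n vs \<and> indep n vs)"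

definition vec_subspace :: "nat \<Rightarrow> 'a::field vec set \<Rightarrow> bool" where
  "vec_subspace n W \<longleftrightarrow> W \<subseteq> carrier_vec n \<and> 0\<^sub>v n \<in> W \<and> (\<forall>v\<in>W. \<forall>w\<in>W. v + w \<in> W) \<and> (\<forall>c. \<forall>v\<in>W. c \<cdot>\<^sub>v v \<in> W)"

lemma vec_subspaceD:
  assumes "vec_subspace n W"
  shows "W \<subseteq> carrier_vec n" "0\<^sub>v n \<in> W" "v \<in> W \<Longrightarrow> w \<in> W \<Longrightarrow> v + w \<in> W" "v \<in> W \<Longrightarrow> c \<cdot>\<^sub>v v \<in> W"
  using assms unfolding vec_subspace_def by blast+

lemma vec_subspace_diff:
  assumes "vec_subspace n W" "v \<in> W" "w \<in> W"
  shows "v - w \<in> W"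
proof -
  have "v - w = v + (-1) \<cdot>\<^sub>v w"
    using vec_subspaceD(1)[OF assms(1)] assms(2,3) by (auto intro!: eq_vecI)
  thus ?thesis using vec_subspaceD[OF assms(1)] assms(2,3) by metis
qed

lemma vec_subspace_carrier_vec: "vec_subspace n (carrier_vec n)"
  by (auto simp: vec_subspace_def)

lemma indep_carrier: "indep n vs \<Longrightarrow> set vs \<subseteq> carrier_vec n"
  by (induction vs) auto

lemma list_span_image: "list_span n vs = (\<lambda>cs. lin_comb n cs vs) ` {cs. length cs = length vs}"
  by (auto simp: list_span_def)

lemma lin_comb_in_subspace:
  assumes "vec_subspace n W" "set vs \<subseteq> W"
  shows "lin_comb n cs vs \<in> W"
  using assms(2)
proof (induction vs arbitrary: cs)
  case (Cons v vs)
  thus ?case using vec_subspaceD[OF assms(1)] by (cases cs) auto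
qed (use vec_subspaceD(2)[OF assms(1)] in simp)

lemma lin_comb_carrier [simp]: "set vs \<subseteq> carrier_vec n \<Longrightarrow> lin_comb n cs vs \<in> carrier_vec n"
  by (rule lin_comb_in_subspace[OF vec_subspace_carrier_vec])

lemma list_span_subset: "vec_subspace n W \<Longrightarrow> set vs \<subseteq> W \<Longrightarrow> list_span n vs \<subseteq> W"
  by (auto simp: list_span_def intro: lin_comb_in_subspace)

lemma list_span_Cons:
  fixes v :: "'a::field vec"
  shows "list_span n (v # vs) = {c \<cdot>\<^sub>v v + p | c p. p \<in> list_span n vs}"
proof (intro equalityI subsetI)
  fix w assume "w \<in> list_span n (v # vs)"
  then obtain bs where w: "w = lin_comb n bs (v # vs)" and len: "length bs = Suc (length vs)"
    unfolding list_span_def by force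
  from len obtain c cs where bs: "bs = c # cs" and cs: "length cs = length vs"
    by (cases bs) simp_all
  have "w = c \<cdot>\<^sub>v v + lin_comb n cs vs" by (simp add: w bs)
  moreover have "lin_comb n cs vs \<in> list_span n vs" unfolding list_span_def using cs by blast
  ultimately show "w \<in> {c \<cdot>\<^sub>v v + p | c p. p \<in> list_span n vs}" by blast
next
  fix w assume "w \<in> {c \<cdot>\<^sub>v v + p | c p. p \<in> list_span n vs}"
  then obtain c p where w: "w = c \<cdot>\<^sub>v v + p" and "p \<in> list_span n vs" by blast
  then obtain cs where p: "p = lin_comb n cs vs" and cs: "length cs = length vs"
    unfolding list_span_def by blast
  have "w = lin_comb n (c # cs) (v # vs)" by (simp add: w p)
  moreover have "length (c # cs) = length (v # vs)" using cs by simp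
  ultimately show "w \<in> list_span n (v # vs)" unfolding list_span_def by blast
qed

lemma vec_subspace_list_span: "set vs \<subseteq> carrier_vec n \<Longrightarrow> vec_subspace n (list_span n vs)"
proof (induction vs)
  case Nil
  show ?case by (auto simp: list_span_def vec_subspace_def)
next
  case (Cons v vs)
  hence v: "v \<in> carrier_vec n" and S: "vec_subspace n (list_span n vs)" by auto
  note S' = vec_subspaceD[OF S]
  show ?case
    unfolding vec_subspace_def list_span_Cons subset_iff Ball_def mem_Collect_eq
  proof (intro conjI allI impI; (elim exE conjE, hypsubst)?)
    show "\<exists>c p. 0\<^sub>v n = c \<cdot>\<^sub>v v + p \<and> p \<in> list_span n vs"
      using v S'(2) by (auto intro!: exI[of _ 0] exI[of _ "0\<^sub>v n"] eq_vecI)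
  next
    fix c p assume "p \<in> list_span n vs"
    thus "c \<cdot>\<^sub>v v + p \<in> carrier_vec n" using v S'(1) by auto
  next
    fix c p d r assume *: "p \<in> list_span n vs" "r \<in> list_span n vs"
    hence "p \<in> carrier_vec n" "r \<in> carrier_vec n" using S'(1) by auto
    hence "c \<cdot>\<^sub>v v + p + (d \<cdot>\<^sub>v v + r) = (c + d) \<cdot>\<^sub>v v + (p + r)"
      using v by (intro eq_vecI) (simp_all add: algebra_simps)
    thus "\<exists>c' p'. c \<cdot>\<^sub>v v + p + (d \<cdot>\<^sub>v v + r) = c' \<cdot>\<^sub>v v + p' \<and> p' \<in> list_span n vs"
      using * S'(3) by blast
  next
    fix c d p assume *: "p \<in> list_span n vs"
    hence "p \<in> carrier_vec n" using S'(1) by auto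
    hence "c \<cdot>\<^sub>v (d \<cdot>\<^sub>v v + p) = (c * d) \<cdot>\<^sub>v v + c \<cdot>\<^sub>v p"
      using v by (intro eq_vecI) (simp_all add: algebra_simps)
    thus "\<exists>c' p'. c \<cdot>\<^sub>v (d \<cdot>\<^sub>v v + p) = c' \<cdot>\<^sub>v v + p' \<and> p' \<in> list_span n vs"
      using * S'(4) by blast
  qed
qed

text \<open>
  Two different combinations with equal values would differ in the coefficient of the head (otherwise the tail is
  at fault), and dividing by that difference would put the head into the span of the tail.
\<close>

lemma inj_on_lin_comb: "indep n vs \<Longrightarrow> inj_on (\<lambda>cs. lin_comb n cs vs) {cs. length cs = length vs}"
proof (induction vs)
  case (Cons v vs)
  hence v: "v \<in> carrier_vec n" "v \<notin> list_span n vs" and vs: "set vs \<subseteq> carrier_vec n"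
    and inj: "inj_on (\<lambda>cs. lin_comb n cs vs) {cs. length cs = length vs}"
    by (auto dest: indep_carrier)
  note S = vec_subspace_list_span[OF vs]
  show ?case
  proof (rule inj_onI, clarify)
    fix as bs assume len: "length as = length (v # vs)" "length bs = length (v # vs)"
      and eq: "lin_comb n as (v # vs) = lin_comb n bs (v # vs)"
    then obtain a as' b bs' where as: "as = a # as'" and bs: "bs = b # bs'"
      by (metis length_Suc_conv)
    define p r where "p = lin_comb n as' vs" and "r = lin_comb n bs' vs"
    have pr: "p \<in> list_span n vs" "r \<in> list_span n vs"
      using len by (auto simp: as bs p_def r_def list_span_def)
    hence pr': "p \<in> carrier_vec n" "r \<in> carrier_vec n" using vec_subspaceD(1)[OF S] by auto
    have e: "a \<cdot>\<^sub>v v + p = b \<cdot>\<^sub>v v + r" using eq by (simp add: as bs p_def r_def)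
    hence comp: "a * v $ i + p $ i = b * v $ i + r $ i" if "i < n" for i
    proof -
      have "(a \<cdot>\<^sub>v v + p) $ i = (b \<cdot>\<^sub>v v + r) $ i" by (simp only: e)
      thus ?thesis using v pr' that by auto
    qed
    have "a = b"
    proof (rule ccontr)
      assume ab: "a \<noteq> b"
      have "v = (1 / (a - b)) \<cdot>\<^sub>v (r - p)"
      proof (rule eq_vecI)
        fix i assume "i < dim_vec ((1 / (a - b)) \<cdot>\<^sub>v (r - p))"
        hence i: "i < n" using pr' by simp
        have "(a - b) * v $ i = r $ i - p $ i"
          using comp[OF i] by (simp add: algebra_simps)
        thus "v $ i = ((1 / (a - b)) \<cdot>\<^sub>v (r - p)) $ i"
          using ab i v pr' by (simp add: field_simps)
      qed (use v pr' in auto)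
      hence "v \<in> list_span n vs" using vec_subspaceD(4)[OF S] vec_subspace_diff[OF S] pr by metis
      thus False using v by simp
    qed
    moreover have "p = r"
      using comp pr' \<open>a = b\<close> by (intro eq_vecI) auto
    hence "as' = bs'" using inj len by (auto simp: as bs p_def r_def inj_on_def)
    ultimately show "as = bs" by (simp add: as bs)
  qed
qed (simp add: inj_on_def)

lemma card_list_span:
  fixes vs :: "'a::{finite,field} vec list"
  shows "indep n vs \<Longrightarrow> card (list_span n vs) = CARD('a) ^ length vs"
  by (simp add: list_span_image card_image[OF inj_on_lin_comb] card_lists_length)

text \<open>
  There are \<open>q\<^sup>d - q\<^sup>k\<close> ways to extend an independent list of length \<open>k\<close>: the complement of its span.
\<close>

lemma card_indep_lists_in_subspace:
  fixes W :: "'a::{finite,field} vec set"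
  assumes W: "vec_subspace n W" and card: "card W = CARD('a) ^ d"
  shows "real (card {vs. length vs = k \<and> set vs \<subseteq> W \<and> indep n vs}) =
           (\<Prod>i<k. real CARD('a) ^ d - real CARD('a) ^ i)"
proof (induction k)
  case 0
  have "{vs. length vs = 0 \<and> set vs \<subseteq> W \<and> indep n vs} = {[]}" by auto
  thus ?case by simp
next
  case (Suc k)
  define L where "L = {vs. length vs = k \<and> set vs \<subseteq> W \<and> indep n vs}"
  have finW: "finite W" by (rule finite_subset[OF vec_subspaceD(1)[OF W]]) simp
  have finL: "finite L"
    by (rule finite_subset[OF _ finite_lists_length_eq[OF finW, of k]]) (auto simp: L_def)
  have diff: "real (card (W - list_span n vs)) = real CARD('a) ^ d - real CARD('a) ^ k" if "vs \<in> L" for vs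
  proof -
    have sub: "list_span n vs \<subseteq> W" using that by (intro list_span_subset[OF W]) (simp add: L_def)
    hence "card (W - list_span n vs) = card W - card (list_span n vs)"
      using finW by (intro card_Diff_subset) (auto intro: finite_subset)
    moreover have "card (list_span n vs) \<le> card W" using sub finW by (rule card_mono[rotated])
    moreover have "card (list_span n vs) = CARD('a) ^ k" using that by (simp add: card_list_span L_def)
    ultimately show ?thesis using card by simp
  qed
  have "{vs. length vs = Suc k \<and> set vs \<subseteq> W \<and> indep n vs} =
        (\<lambda>(vs, v). v # vs) ` (SIGMA vs:L. W - list_span n vs)"
    using vec_subspaceD(1)[OF W] by (auto simp: L_def length_Suc_conv image_iff)
  hence "card {vs. length vs = Suc k \<and> set vs \<subseteq> W \<and> indep n vs} = card (SIGMA vs:L. W - list_span n vs)"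
    by (simp add: card_image inj_on_def split_def prod_eq_iff)
  also have "\<dots> = (\<Sum>vs\<in>L. card (W - list_span n vs))"
    using finL finW by (simp add: card_SigmaI)
  finally have "real (card {vs. length vs = Suc k \<and> set vs \<subseteq> W \<and> indep n vs}) =
      real (card L) * (real CARD('a) ^ d - real CARD('a) ^ k)"
    by (simp add: diff)
  thus ?case using Suc by (simp add: L_def)
qed

text \<open>
  Translation by a preimage of \<open>a\<close> identifies the fibre over \<open>a\<close> with the kernel, so all \<open>q\<close> fibres of a nonzero
  functional have equal size.
\<close>

lemma card_functional_fibre:
  fixes W :: "'a::{finite,field} vec set" and f :: "'a vec \<Rightarrow> 'a"
  assumes W: "vec_subspace n W"
    and add: "\<And>v w. v \<in> W \<Longrightarrow> w \<in> W \<Longrightarrow> f (v + w) = f v + f w"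
    and smult: "\<And>c v. v \<in> W \<Longrightarrow> f (c \<cdot>\<^sub>v v) = c * f v"
    and nonzero: "u \<in> W" "f u \<noteq> 0"
  shows "CARD('a) * card {w \<in> W. f w = 0} = card W"
proof -
  have finW: "finite W" by (rule finite_subset[OF vec_subspaceD(1)[OF W]]) simp
  have "card {w \<in> W. f w = a} = card {w \<in> W. f w = 0}" for a
  proof -
    define x where "x = (a / f u) \<cdot>\<^sub>v u"
    have x: "x \<in> W" "f x = a" using vec_subspaceD(4)[OF W] smult nonzero by (auto simp: x_def)
    have f_diff: "f (w - x) = f w - a" if "w \<in> W" for w
    proof -
      have "w \<in> carrier_vec n" "x \<in> carrier_vec n" using that x(1) vec_subspaceD(1)[OF W] by auto
      hence "w = (w - x) + x" by (intro eq_vecI) simp_all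
      thus ?thesis using add[OF vec_subspace_diff[OF W that x(1)] x(1)] x(2) by simp
    qed
    have "bij_betw (\<lambda>w. w - x) {w \<in> W. f w = a} {w \<in> W. f w = 0}"
    proof (rule bij_betwI[where g = "\<lambda>w. w + x"])
      show "(\<lambda>w. w - x) \<in> {w \<in> W. f w = a} \<rightarrow> {w \<in> W. f w = 0}"
        using vec_subspace_diff[OF W] x f_diff by auto
      show "(\<lambda>w. w + x) \<in> {w \<in> W. f w = 0} \<rightarrow> {w \<in> W. f w = a}"
        using vec_subspaceD(3)[OF W] x add by auto
      fix w
      have x': "x \<in> carrier_vec n" using vec_subspaceD(1)[OF W] x by auto
      {
        assume "w \<in> {w \<in> W. f w = a}"
        hence "w \<in> carrier_vec n" using vec_subspaceD(1)[OF W] by auto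
        thus "w - x + x = w" using x' by (intro eq_vecI) simp_all
      next
        assume "w \<in> {w \<in> W. f w = 0}"
        hence "w \<in> carrier_vec n" using vec_subspaceD(1)[OF W] by auto
        thus "w + x - x = w" using x' by (intro eq_vecI) simp_all
      }
    qed
    thus ?thesis by (rule bij_betw_same_card)
  qed
  hence "(\<Sum>a\<in>UNIV. card {w \<in> W. f w = a}) = (\<Sum>a::'a\<in>UNIV. card {w \<in> W. f w = 0})"
    by (rule sum.cong[OF refl])
  moreover have "card W = (\<Sum>a\<in>UNIV. card {w \<in> W. f w = a})"
    using sum.group[OF finW, of UNIV f "\<lambda>_. 1 :: nat"] by simp
  ultimately show ?thesis by simp
qed

section \<open>Alternating forms, orthogonal complements and Gram matrices\<close>

lemma two_le_card_field: "2 \<le> CARD('a::{finite,field})"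
proof -
  have "card {0, 1 :: 'a} \<le> CARD('a)" by (intro card_mono) auto
  thus ?thesis by simp
qed

fun list_dot :: "'a::field list \<Rightarrow> 'a list \<Rightarrow> 'a" where
  "list_dot (c # cs) (b # bs) = c * b + list_dot cs bs"
| "list_dot _ _ = 0"

locale symplectic_form =
  fixes n :: nat and J :: "'a::{finite,field} mat"
  assumes J [simp]: "J \<in> carrier_mat n n"
    and alternating: "v \<in> carrier_vec n \<Longrightarrow> v \<bullet> (J *\<^sub>v v) = 0"
    and nondegenerate: "v \<in> carrier_vec n \<Longrightarrow> (\<And>w. w \<in> carrier_vec n \<Longrightarrow> v \<bullet> (J *\<^sub>v w) = 0) \<Longrightarrow> v = 0\<^sub>v n"
begin

abbreviation V :: "'a vec set" where "V \<equiv> carrier_vec n"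

definition form :: "'a vec \<Rightarrow> 'a vec \<Rightarrow> 'a" where
  "form v w = v \<bullet> (J *\<^sub>v w)"

lemma form_add_left: "u \<in> V \<Longrightarrow> v \<in> V \<Longrightarrow> w \<in> V \<Longrightarrow> form (u + v) w = form u w + form v w"
  unfolding form_def by (rule add_scalar_prod_distrib) (auto intro: mult_mat_vec_carrier[OF J])

lemma form_smult_left: "v \<in> V \<Longrightarrow> w \<in> V \<Longrightarrow> form (c \<cdot>\<^sub>v v) w = c * form v w"
  unfolding form_def by (rule smult_scalar_prod_distrib) (auto intro: mult_mat_vec_carrier[OF J])

lemma form_add_right: "u \<in> V \<Longrightarrow> v \<in> V \<Longrightarrow> w \<in> V \<Longrightarrow> form w (u + v) = form w u + form w v"
  unfolding form_def mult_add_distrib_mat_vec[OF J]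
  by (rule scalar_prod_add_distrib) (auto intro: mult_mat_vec_carrier[OF J])

lemma form_smult_right: "v \<in> V \<Longrightarrow> w \<in> V \<Longrightarrow> form w (c \<cdot>\<^sub>v v) = c * form w v"
  unfolding form_def mult_mat_vec[OF J]
  by (rule scalar_prod_smult_distrib) (auto intro: mult_mat_vec_carrier[OF J])

lemma form_self: "v \<in> V \<Longrightarrow> form v v = 0"
  unfolding form_def by (rule alternating)

lemma form_antisym:
  assumes "v \<in> V" "w \<in> V"
  shows "form w v = - form v w"
proof -
  have "0 = form (v + w) (v + w)" using assms by (simp add: form_self)
  also have "\<dots> = form v (v + w) + form w (v + w)"
    using assms by (intro form_add_left) auto
  also have "\<dots> = form v w + form w v"
    using assms by (simp add: form_add_right form_self)
  finally show ?thesis by (simp add: eq_neg_iff_add_eq_0 add.commute)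
qed

lemma form_zero_left: "v \<in> V \<Longrightarrow> form (0\<^sub>v n) v = 0"
  unfolding form_def by (rule scalar_prod_left_zero) (rule mult_mat_vec_carrier[OF J])

lemma form_zero_right: "v \<in> V \<Longrightarrow> form v (0\<^sub>v n) = 0"
  using form_antisym[of "0\<^sub>v n" v] by (simp add: form_zero_left)

lemma form_nonzero_left: "v \<in> V \<Longrightarrow> v \<noteq> 0\<^sub>v n \<Longrightarrow> \<exists>w\<in>V. form v w \<noteq> 0"
  using nondegenerate[of v] by (auto simp: form_def)

lemma form_nonzero_right: "v \<in> V \<Longrightarrow> v \<noteq> 0\<^sub>v n \<Longrightarrow> \<exists>w\<in>V. form w v \<noteq> 0"
  using form_nonzero_left[of v] form_antisym[of v] by (metis neg_equal_0_iff_equal)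

lemma form_lin_comb_right:
  assumes "v \<in> V" "set xs \<subseteq> V"
  shows "form v (lin_comb n cs xs) = list_dot cs (map (form v) xs)"
  using assms(2)
proof (induction xs arbitrary: cs)
  case (Cons x xs)
  thus ?case using assms(1)
    by (cases cs) (simp_all add: form_zero_right form_add_right form_smult_right)
qed (simp add: form_zero_right assms(1))

definition perp :: "'a vec set \<Rightarrow> 'a vec set" where
  "perp W = {v \<in> V. \<forall>w\<in>W. form v w = 0}"

lemma sum_If_add:
  "finite A \<Longrightarrow> (\<Sum>x\<in>A. if P x then a + b else (b :: nat)) = card A * b + card {x \<in> A. P x} * a"
proof -
  assume "finite A"
  have "(\<Sum>x\<in>A. if P x then a + b else b) = (\<Sum>x\<in>A. b + (if P x then a else 0))"
    by (intro sum.cong) auto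
  thus ?thesis using \<open>finite A\<close> by (simp add: sum.distrib sum.If_cases Int_def)
qed

text \<open>
  Count the pairs \<open>(v, w)\<close> in \<open>V \<times> W\<close> with \<open>form v w = 0\<close> in two ways. For fixed \<open>v\<close>, the functional \<open>form v\<close> on
  \<open>W\<close> is zero or has a kernel of index \<open>q\<close>, according to whether \<open>v\<close> is in \<open>perp W\<close>. For fixed \<open>w\<close>, the same
  dichotomy on \<open>V\<close> depends on whether \<open>w\<close> is zero, by nondegeneracy. Comparing the totals avoids
  bases and rank arguments.
\<close>

theorem card_perp:
  assumes W: "vec_subspace n W"
  shows "card (perp W) * card W = CARD('a) ^ n"
proof -
  let ?q = "CARD('a)"
  obtain q' where q': "?q = Suc q'" and q'_pos: "q' > 0"
    using two_le_card_field[where 'a = 'a] by (cases ?q) auto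
  have WV: "W \<subseteq> V" by (rule vec_subspaceD(1)[OF W])
  have finW: "finite W" by (rule finite_subset[OF WV]) simp
  have left: "?q * card {w \<in> W. form v w = 0} = (if v \<in> perp W then q' * card W + card W else card W)"
    if v: "v \<in> V" for v
  proof (cases "v \<in> perp W")
    case True
    hence "{w \<in> W. form v w = 0} = W" by (auto simp: perp_def)
    thus ?thesis using True by (simp add: q')
  next
    case False
    then obtain u where "u \<in> W" "form v u \<noteq> 0" using v by (auto simp: perp_def)
    hence "?q * card {w \<in> W. form v w = 0} = card W"
      using v WV by (intro card_functional_fibre[OF W]) (auto intro!: form_add_right form_smult_right)
    thus ?thesis using False by simp
  qed
  have right: "?q * card {v \<in> V. form v w = 0} = (if w = 0\<^sub>v n then q' * card V + card V else card V)"
    if w: "w \<in> W" for w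
  proof (cases "w = 0\<^sub>v n")
    case True
    hence "{v \<in> V. form v w = 0} = V" by (auto simp: form_zero_right)
    thus ?thesis using True by (simp add: q')
  next
    case False
    then obtain u where "u \<in> V" "form u w \<noteq> 0" using form_nonzero_right w WV by blast
    hence "?q * card {v \<in> V. form v w = 0} = card V"
      using w WV by (intro card_functional_fibre[OF vec_subspace_carrier_vec]) (auto intro!: form_add_left form_smult_left)
    thus ?thesis using False by simp
  qed
  have "card V * card W + card (perp W) * (q' * card W) = (\<Sum>v\<in>V. ?q * card {w \<in> W. form v w = 0})"
  proof -
    have "{v \<in> V. v \<in> perp W} = perp W" by (auto simp: perp_def)
    thus ?thesis using sum_If_add[of V "\<lambda>v. v \<in> perp W" "q' * card W" "card W"] by (simp add: left)
  qed
  also have "\<dots> = ?q * card {p \<in> V \<times> W. form (fst p) (snd p) = 0}"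
  proof -
    have "{p \<in> V \<times> W. form (fst p) (snd p) = 0} = (SIGMA v:V. {w \<in> W. form v w = 0})" by auto
    thus ?thesis using finW by (simp add: card_SigmaI sum_distrib_left)
  qed
  also have "\<dots> = (\<Sum>w\<in>W. ?q * card {v \<in> V. form v w = 0})"
  proof -
    have "{p \<in> V \<times> W. form (fst p) (snd p) = 0} = prod.swap ` (SIGMA w:W. {v \<in> V. form v w = 0})"
      by (auto simp: image_iff)
    hence "card {p \<in> V \<times> W. form (fst p) (snd p) = 0} = card (SIGMA w:W. {v \<in> V. form v w = 0})"
      by (simp add: card_image)
    thus ?thesis using finW by (simp add: card_SigmaI sum_distrib_left)
  qed
  also have "\<dots> = card W * card V + q' * card V"
  proof -
    have "{w \<in> W. w = 0\<^sub>v n} = {0\<^sub>v n}" using vec_subspaceD(2)[OF W] by auto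
    thus ?thesis using finW sum_If_add[of W "\<lambda>w. w = 0\<^sub>v n" "q' * card V" "card V"] by (simp add: right)
  qed
  finally have "q' * (card (perp W) * card W) = q' * card V" by (simp add: mult_ac)
  thus ?thesis using q'_pos by (simp add: card_vectors)
qed

definition solutions :: "'a vec list \<Rightarrow> 'a list \<Rightarrow> 'a vec set" where
  "solutions xs bs = {v \<in> V. map (form v) xs = bs}"

text \<open>
  A nonempty solution set is a translate of the homogeneous one, so it has at most \<open>card (perp (list_span n xs))\<close>
  elements. The \<open>q\<^bsup>length xs\<^esup>\<close> solution sets partition \<open>V\<close>, and by \<open>card_perp\<close> their total size
  forces equality everywhere; in particular every system is solvable.
\<close>

lemma card_solutions:
  assumes xs: "indep n xs" and bs: "length bs = length xs"
  shows "card (solutions xs bs) * CARD('a) ^ length xs = CARD('a) ^ n"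
proof -
  let ?B = "{bs :: 'a list. length bs = length xs}" and ?W = "list_span n xs"
  have xsV: "set xs \<subseteq> V" using indep_carrier[OF xs] .
  have W: "vec_subspace n ?W" by (rule vec_subspace_list_span[OF xsV])
  have perp: "card (perp ?W) * CARD('a) ^ length xs = CARD('a) ^ n"
    using card_perp[OF W] by (simp add: card_list_span[OF xs])
  have le: "card (solutions xs cs) \<le> card (perp ?W)" for cs
  proof (cases "solutions xs cs = {}")
    case False
    then obtain v0 where v0: "v0 \<in> V" "map (form v0) xs = cs" by (auto simp: solutions_def)
    have mem: "v + (-1) \<cdot>\<^sub>v v0 \<in> perp ?W" if "v \<in> solutions xs cs" for v
    proof -
      have v: "v \<in> V" "map (form v) xs = cs" using that by (auto simp: solutions_def)
      have "form (v + (-1) \<cdot>\<^sub>v v0) w = 0" if w_span: "w \<in> ?W" for w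
      proof -
        obtain ds where w: "w = lin_comb n ds xs" using w_span by (auto simp: list_span_def)
        hence "w \<in> V" using xsV by simp
        hence "form (v + (-1) \<cdot>\<^sub>v v0) w = form v w - form v0 w"
          using v(1) v0(1) by (simp add: form_add_left form_smult_left)
        also have "\<dots> = 0" unfolding w using v v0 xsV by (simp add: form_lin_comb_right)
        finally show ?thesis .
      qed
      thus ?thesis using v(1) v0(1) by (simp add: perp_def)
    qed
    have "inj_on (\<lambda>v. v + (-1) \<cdot>\<^sub>v v0) (solutions xs cs)"
    proof (rule inj_onI)
      fix u v assume u: "u \<in> solutions xs cs" and v: "v \<in> solutions xs cs"
        and eq: "u + (-1) \<cdot>\<^sub>v v0 = v + (-1) \<cdot>\<^sub>v v0"
      show "u = v"
      proof (rule eq_vecI)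
        fix i assume "i < dim_vec v"
        hence "i < n" "u \<in> V" "v \<in> V" using u v by (auto simp: solutions_def)
        moreover have "(u + (-1) \<cdot>\<^sub>v v0) $ i = (v + (-1) \<cdot>\<^sub>v v0) $ i" by (simp only: eq)
        ultimately show "u $ i = v $ i" using v0(1) by auto
      qed (use u v in \<open>auto simp: solutions_def\<close>)
    qed
    thus ?thesis using mem by (intro card_inj_on_le[of "\<lambda>v. v + (-1) \<cdot>\<^sub>v v0"]) (auto simp: perp_def)
  qed simp
  have "(\<Sum>cs\<in>?B. card (solutions xs cs)) = card V"
  proof -
    have "(\<lambda>v. map (form v) xs) ` V \<subseteq> ?B" by auto
    thus ?thesis
      unfolding solutions_def using sum.group[of V ?B "\<lambda>v. map (form v) xs" "\<lambda>_. 1 :: nat"]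
      by (simp add: finite_lists_length)
  qed
  also have "\<dots> = (\<Sum>cs\<in>?B. card (perp ?W))"
    using perp by (simp add: card_vectors card_lists_length mult.commute)
  finally have "card (solutions xs bs) = card (perp ?W)"
    using sum_mono_inv[of "\<lambda>cs. card (solutions xs cs)" ?B "\<lambda>_. card (perp ?W)" bs] le bs
    by (simp add: finite_lists_length)
  thus ?thesis using perp by simp
qed

text \<open>
  The Gram matrix above the diagonal, one row for each vector. An alternating form is determined by
  these entries, and rows are prepended in the same way as vectors are.
\<close>

fun gram :: "'a vec list \<Rightarrow> 'a list list" where
  "gram [] = []"
| "gram (v # vs) = map (form v) vs # gram vs"

lemma length_gram [simp]: "length (gram xs) = length xs"
  by (induction xs) auto

text \<open>
  With the same coefficients, a combination of \<open>xs\<close> pairs with \<open>xs\<close> as the one of \<open>ys\<close> pairs with \<open>ys\<close>. The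
  entries below the diagonal, missing in \<open>gram\<close>, come from antisymmetry.
\<close>

lemma gram_determines_form_lin_comb:
  assumes "set xs \<subseteq> V" "set ys \<subseteq> V" "gram xs = gram ys"
  shows "map (form (lin_comb n cs xs)) xs = map (form (lin_comb n cs ys)) ys"
  using assms
proof (induction xs arbitrary: ys cs)
  case Nil
  hence "ys = []" by (cases ys) auto
  thus ?case by simp
next
  case (Cons x xs)
  then obtain y ys' where ys: "ys = y # ys'" by (cases ys) auto
  have c: "x \<in> V" "y \<in> V" "set xs \<subseteq> V" "set ys' \<subseteq> V" using Cons.prems by (auto simp: ys)
  have eq: "map (form x) xs = map (form y) ys'" and g: "gram xs = gram ys'"
    using Cons.prems(3) by (auto simp: ys)
  have len: "length ys' = length xs" using arg_cong[OF g, of length] by simp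
  show ?case
  proof (cases cs)
    case Nil
    have zero: "map (form (0\<^sub>v n)) zs = replicate (length zs) 0" if "set zs \<subseteq> V" for zs
      using that by (induction zs) (simp_all add: form_zero_left)
    show ?thesis
      using Cons.prems(1,2) arg_cong[OF Cons.prems(3), of length]
      by (simp only: Nil lin_comb.simps zero length_gram)
  next
    case (Cons b bs)
    let ?p = "lin_comb n bs xs" and ?r = "lin_comb n bs ys'"
    have pr: "?p \<in> V" "?r \<in> V" using c by auto
    have IH: "map (form ?p) xs = map (form ?r) ys'" using Cons.IH[OF c(3,4) g] .
    have "form ?p x = form ?r y"
      using c pr eq by (simp add: form_antisym[of x ?p] form_antisym[of y ?r] form_lin_comb_right)
    hence "form (b \<cdot>\<^sub>v x + ?p) x = form (b \<cdot>\<^sub>v y + ?r) y"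
      using c pr by (simp add: form_add_left form_smult_left form_self)
    moreover have "map (form (b \<cdot>\<^sub>v x + ?p)) xs = map (form (b \<cdot>\<^sub>v y + ?r)) ys'"
    proof (rule nth_equalityI)
      fix i assume "i < length (map (form (b \<cdot>\<^sub>v x + ?p)) xs)"
      hence i: "i < length xs" by simp
      have v: "xs ! i \<in> V" "ys' ! i \<in> V" using i len c by auto
      have "form x (xs ! i) = form y (ys' ! i)" "form ?p (xs ! i) = form ?r (ys' ! i)"
        using arg_cong[OF eq, of "\<lambda>l. l ! i"] arg_cong[OF IH, of "\<lambda>l. l ! i"] i len by auto
      thus "map (form (b \<cdot>\<^sub>v x + ?p)) xs ! i = map (form (b \<cdot>\<^sub>v y + ?r)) ys' ! i"
        using i len c pr v by (simp add: form_add_left form_smult_left)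
    qed (simp add: len)
    ultimately show ?thesis by (simp add: ys \<open>cs = b # bs\<close>)
  qed
qed

definition extensions :: "'a vec list \<Rightarrow> 'a list \<Rightarrow> 'a vec set" where
  "extensions xs bs = solutions xs bs - list_span n xs"

text \<open>
  Solutions inside the span of \<open>xs\<close> correspond to coefficient lists, and being a solution is a
  condition on coefficients and Gram matrix only; hence \<open>card_extensions_cong\<close>.
\<close>

lemma card_extensions:
  assumes "indep n xs" "length bs = length xs"
  shows "card (extensions xs bs) =
    CARD('a) ^ n div CARD('a) ^ length xs -
    card {cs. length cs = length xs \<and> map (form (lin_comb n cs xs)) xs = bs}"
proof -
  have xsV: "set xs \<subseteq> V" using indep_carrier[OF assms(1)] .
  let ?C = "{cs. length cs = length xs \<and> map (form (lin_comb n cs xs)) xs = bs}"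
  have "solutions xs bs \<inter> list_span n xs = (\<lambda>cs. lin_comb n cs xs) ` ?C"
    using xsV by (auto simp: solutions_def list_span_def)
  moreover have "inj_on (\<lambda>cs. lin_comb n cs xs) ?C"
    by (rule inj_on_subset[OF inj_on_lin_comb[OF assms(1)]]) auto
  ultimately have "card (solutions xs bs \<inter> list_span n xs) = card ?C"
    by (simp add: card_image)
  moreover have "finite (solutions xs bs)" by (simp add: solutions_def)
  moreover have "card (solutions xs bs) = CARD('a) ^ n div CARD('a) ^ length xs"
    by (simp flip: card_solutions[OF assms])
  ultimately show ?thesis
    by (simp add: extensions_def card_Diff_subset_Int)
qed

lemma card_extensions_cong:
  assumes "indep n xs" "indep n ys" "gram xs = gram ys" "length bs = length xs"
  shows "card (extensions xs bs) = card (extensions ys bs)"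
proof -
  have "length ys = length xs" using arg_cong[OF assms(3), of length] by simp
  thus ?thesis using assms
    by (simp add: card_extensions gram_determines_form_lin_comb[OF indep_carrier[OF assms(1)] indep_carrier[OF assms(2)] assms(3)])
qed

text \<open>
  There are \<open>q\<^bsup>n - k\<^esup>\<close> solutions, of which at most \<open>q\<^sup>k\<close> lie in the span, where \<open>k = length xs\<close>.
\<close>

lemma extensions_nonempty:
  assumes "indep n xs" "length bs = length xs" "2 * length xs < n"
  shows "extensions xs bs \<noteq> {}"
proof
  assume "extensions xs bs = {}"
  hence "card (extensions xs bs) = 0" by simp
  hence "CARD('a) ^ n div CARD('a) ^ length xs \<le>
      card {cs. length cs = length xs \<and> map (form (lin_comb n cs xs)) xs = bs}"
    unfolding card_extensions[OF assms(1,2)] by (simp only: diff_is_0_eq)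
  also have "\<dots> \<le> card {cs :: 'a list. length cs = length xs}"
    by (intro card_mono finite_lists_length) auto
  also have "\<dots> = CARD('a) ^ length xs" by (rule card_lists_length)
  also have "\<dots> < CARD('a) ^ (n - length xs)"
    using assms(3) two_le_card_field[where 'a = 'a] by (intro power_strict_increasing) auto
  also have "\<dots> = CARD('a) ^ n div CARD('a) ^ length xs"
    using assms(3) by (intro power_diff) auto
  finally show False by simp
qed

lemma indep_Cons_extension: "indep n xs \<Longrightarrow> v \<in> extensions xs bs \<Longrightarrow> indep n (v # xs)"
  by (simp add: extensions_def solutions_def)

lemma gram_Cons_extension: "v \<in> extensions xs bs \<Longrightarrow> gram (v # xs) = bs # gram xs"
  by (simp add: extensions_def solutions_def)

text \<open>
  Extend \<open>xs\<close> by any vector outside its span. The pairings of that vector with \<open>xs\<close> can be realised over \<open>ys\<close> by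
  the same number of vectors outside the span of \<open>ys\<close>, hence by at least one.
\<close>

lemma extend_to_bases:
  assumes "indep n xs" "indep n ys" "gram xs = gram ys" "length xs + d = n"
  shows "\<exists>us ws. length us = d \<and> length ws = d \<and> indep n (us @ xs) \<and> indep n (ws @ ys)
           \<and> gram (us @ xs) = gram (ws @ ys)"
  using assms
proof (induction d arbitrary: xs ys)
  case 0
  thus ?case by (intro exI[of _ "[]"]) simp
next
  case (Suc d)
  have sub: "list_span n xs \<subseteq> V"
    using indep_carrier[OF Suc.prems(1)] by (intro list_span_subset vec_subspace_carrier_vec)
  have "card (list_span n xs) < card V"
    unfolding card_list_span[OF Suc.prems(1)] card_vectors
    using Suc.prems(4) two_le_card_field[where 'a = 'a] by (intro power_strict_increasing) auto
  hence "list_span n xs \<noteq> V" by auto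
  then obtain v where v: "v \<in> V" "v \<notin> list_span n xs" using sub by auto
  define bs where "bs = map (form v) xs"
  have v_ext: "v \<in> extensions xs bs" using v by (simp add: extensions_def solutions_def bs_def)
  have "finite (extensions xs bs)" by (simp add: extensions_def solutions_def)
  hence "card (extensions xs bs) > 0" using v_ext card_gt_0_iff by blast
  hence "card (extensions ys bs) > 0"
    using card_extensions_cong[OF Suc.prems(1-3), of bs] by (simp add: bs_def)
  then obtain w where w_ext: "w \<in> extensions ys bs" by fastforce
  obtain us ws where "length us = d" "length ws = d" "indep n (us @ v # xs)" "indep n (ws @ w # ys)"
      "gram (us @ v # xs) = gram (ws @ w # ys)"
    using Suc.IH[of "v # xs" "w # ys"] Suc.prems v_ext w_ext
      indep_Cons_extension gram_Cons_extension by (metis add_Suc_shift length_Cons)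
  thus ?case by (intro exI[of _ "us @ [v]"] exI[of _ "ws @ [w]"]) simp
qed

end

section \<open>Witt's theorem and orbits of independent lists\<close>

lemma vec_of_list_carrier: "length cs = n \<Longrightarrow> vec_of_list cs \<in> carrier_vec n"
  by (metis carrier_vec_dim_vec dim_vec_of_list)

lemma mat_of_cols_square: "length xs = n \<Longrightarrow> mat_of_cols n xs \<in> carrier_mat n n"
  by (metis mat_of_cols_carrier(1))

lemma mat_of_cols_mult_vec:
  assumes "set xs \<subseteq> carrier_vec n" "length cs = length xs"
  shows "mat_of_cols n xs *\<^sub>v vec_of_list cs = lin_comb n cs xs"
proof (rule eq_vecI)
  fix i assume "i < dim_vec (lin_comb n cs xs)"
  hence i: "i < n" using lin_comb_carrier[OF assms(1)] by (metis carrier_vecD)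
  have "lin_comb n cs xs $ i = (\<Sum>j<length xs. cs ! j * xs ! j $ i)"
    using assms
  proof (induction xs arbitrary: cs)
    case Nil
    thus ?case using i by simp
  next
    case (Cons x xs)
    obtain b bs where cs: "cs = b # bs" using Cons.prems by (cases cs) auto
    have "x \<in> carrier_vec n" "lin_comb n bs xs \<in> carrier_vec n" using Cons.prems by auto
    hence "lin_comb n cs (x # xs) $ i = b * x $ i + lin_comb n bs xs $ i"
      using i unfolding cs lin_comb.simps by (subst index_add_vec) auto
    also have "lin_comb n bs xs $ i = (\<Sum>j<length xs. bs ! j * xs ! j $ i)"
      using Cons.prems cs by (intro Cons.IH) auto
    finally show ?case by (simp add: cs sum.lessThan_Suc_shift del: sum.lessThan_Suc)
  qed
  moreover have "(mat_of_cols n xs *\<^sub>v vec_of_list cs) $ i = (\<Sum>j<length xs. cs ! j * xs ! j $ i)"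
    using i assms(2)
    by (simp add: scalar_prod_def mat_of_cols_index vec_of_list_index lessThan_atLeast0 mult.commute)
  ultimately show "(mat_of_cols n xs *\<^sub>v vec_of_list cs) $ i = lin_comb n cs xs $ i" by simp
qed (use carrier_vecD[OF lin_comb_carrier[OF assms(1)]] in simp)

lemma indep_basis_span:
  fixes xs :: "'a::{finite,field} vec list"
  assumes "indep n xs" "length xs = n"
  shows "list_span n xs = carrier_vec n"
proof (rule card_subset_eq)
  show "list_span n xs \<subseteq> carrier_vec n"
    using indep_carrier[OF assms(1)] by (rule list_span_subset[OF vec_subspace_carrier_vec])
qed (simp_all add: card_list_span[OF assms(1)] card_vectors assms(2))

lemma mat_of_basis_invertible:
  fixes xs :: "'a::{finite,field} vec list"
  assumes "indep n xs" "length xs = n"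
  obtains C where "C \<in> carrier_mat n n" "mat_of_cols n xs * C = 1\<^sub>m n" "C * mat_of_cols n xs = 1\<^sub>m n"
proof -
  have xs: "set xs \<subseteq> carrier_vec n" by (rule indep_carrier[OF assms(1)])
  have "\<exists>cs. length cs = n \<and> lin_comb n cs xs = unit_vec n i" for i
  proof -
    have "unit_vec n i \<in> list_span n xs" unfolding indep_basis_span[OF assms] by simp
    thus ?thesis unfolding list_span_def using assms(2) by auto
  qed
  then obtain cs where cs: "length (cs i) = n" "lin_comb n (cs i) xs = unit_vec n i" for i by metis
  define C where "C = mat_of_cols n (map (\<lambda>i. vec_of_list (cs i)) [0..<n])"
  let ?X = "mat_of_cols n xs"
  have X: "?X \<in> carrier_mat n n" using assms(2) by (rule mat_of_cols_square)
  have C: "C \<in> carrier_mat n n" unfolding C_def by (rule mat_of_cols_square) simp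
  have "?X * C = 1\<^sub>m n"
  proof (rule mat_col_eqI)
    fix i assume "i < dim_col (1\<^sub>m n :: 'a mat)"
    hence i: "i < n" by simp
    have "col C i = vec_of_list (cs i)"
      unfolding C_def using i vec_of_list_carrier[OF cs(1)] by (subst col_mat_of_cols) simp_all
    hence "col (?X * C) i = lin_comb n (cs i) xs"
      using i col_mult2[OF X C i] mat_of_cols_mult_vec[OF xs, of "cs i"] cs(1) assms(2) by simp
    thus "col (?X * C) i = col (1\<^sub>m n) i" using i by (simp add: cs(2))
  qed (use X C in auto)
  moreover from this have "C * ?X = 1\<^sub>m n" by (rule mat_mult_left_right_inverse[OF X C])
  ultimately show ?thesis using that C by blast
qed

context symplectic_form
begin

definition isometries :: "'a mat set" where
  "isometries = {x \<in> carrier_mat n n. transpose_mat x * J * x = J}"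

lemma isometries_carrier: "x \<in> isometries \<Longrightarrow> x \<in> carrier_mat n n"
  by (simp add: isometries_def)

lemma finite_isometries: "finite isometries"
  by (rule finite_subset[of _ "carrier_mat n n"]) (auto simp: isometries_def)

lemma one_isometry: "1\<^sub>m n \<in> isometries"
  using left_mult_one_mat[OF J] right_mult_one_mat[OF J] by (simp add: isometries_def)

text \<open>
  Links the matrix equation that defines an isometry to invariance of the form on vectors.
\<close>

lemma form_mult_vec:
  assumes x: "x \<in> carrier_mat n n" and v: "v \<in> V" and w: "w \<in> V"
  shows "form (x *\<^sub>v v) (x *\<^sub>v w) = v \<bullet> ((transpose_mat x * J * x) *\<^sub>v w)"
proof -
  have xw: "x *\<^sub>v w \<in> V" using mult_mat_vec_carrier[OF x w] .
  have xt: "transpose_mat x \<in> carrier_mat n n" using x by simp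
  have "form (x *\<^sub>v v) (x *\<^sub>v w) = v \<bullet> (transpose_mat x *\<^sub>v (J *\<^sub>v (x *\<^sub>v w)))"
    unfolding form_def using transpose_vec_mult_scalar[OF x v mult_mat_vec_carrier[OF J xw]]
    by (metis comm_scalar_prod mult_mat_vec_carrier J x xt v xw)
  also have "transpose_mat x *\<^sub>v (J *\<^sub>v (x *\<^sub>v w)) = (transpose_mat x * J) *\<^sub>v (x *\<^sub>v w)"
    by (rule assoc_mult_mat_vec[symmetric, OF xt J xw])
  also have "\<dots> = (transpose_mat x * J * x) *\<^sub>v w"
    by (rule assoc_mult_mat_vec[symmetric, OF mult_carrier_mat[OF xt J] x w])
  finally show ?thesis .
qed

lemma form_isometry:
  assumes "x \<in> isometries" "v \<in> V" "w \<in> V"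
  shows "form (x *\<^sub>v v) (x *\<^sub>v w) = form v w"
  using form_mult_vec[of x v w] assms by (simp add: isometries_def form_def)

lemma mult_isometry:
  assumes x: "x \<in> isometries" and y: "y \<in> isometries"
  shows "x * y \<in> isometries"
proof -
  have xc: "x \<in> carrier_mat n n" and yc: "y \<in> carrier_mat n n"
    using x y by (auto simp: isometries_def)
  have t: "transpose_mat x \<in> carrier_mat n n" "transpose_mat y \<in> carrier_mat n n"
    using xc yc by auto
  have "transpose_mat (x * y) * J * (x * y) = transpose_mat y * transpose_mat x * J * (x * y)"
    by (simp only: transpose_mult[OF xc yc])
  also have "\<dots> = transpose_mat y * (transpose_mat x * J * x) * y"
    using xc yc t J by (simp add: assoc_mult_mat[of _ n n _ n _ n] mult_carrier_mat[of _ n n _ n])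
  also have "\<dots> = J" using x y by (simp add: isometries_def)
  finally show ?thesis using xc yc by (simp add: isometries_def)
qed

text \<open>
  Nondegeneracy makes an isometry injective: a vector of its kernel would be orthogonal to everything.
\<close>

lemma isometry_inverse:
  assumes x: "x \<in> isometries"
  obtains y where "y \<in> isometries" "x * y = 1\<^sub>m n" "y * x = 1\<^sub>m n"
proof -
  have xc: "x \<in> carrier_mat n n" using x by (rule isometries_carrier)
  have "v = 0\<^sub>v n" if v: "v \<in> V" and 0: "x *\<^sub>v v = 0\<^sub>v n" for v
  proof (rule ccontr)
    assume "v \<noteq> 0\<^sub>v n"
    then obtain w where w: "w \<in> V" "form v w \<noteq> 0" using form_nonzero_left[OF v] by blast
    have "form v w = form (0\<^sub>v n) (x *\<^sub>v w)" using form_isometry[OF x v w(1)] 0 by simp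
    also have "\<dots> = 0" using mult_mat_vec_carrier[OF xc w(1)] by (rule form_zero_left)
    finally show False using w(2) by simp
  qed
  hence "det x \<noteq> 0" using det_0_iff_vec_prod_zero_field[OF xc] by auto
  then obtain y where y: "y \<in> carrier_mat n n" "y * x = 1\<^sub>m n"
    using det_non_zero_imp_unit[OF xc, of "()"] by (auto simp: Units_def ring_mat_def)
  have xy: "x * y = 1\<^sub>m n" using mat_mult_left_right_inverse[OF y(1) xc y(2)] .
  have t: "transpose_mat x \<in> carrier_mat n n" "transpose_mat y \<in> carrier_mat n n"
    using xc y by auto
  have txy: "transpose_mat y * transpose_mat x = 1\<^sub>m n"
    using transpose_mult[OF xc y(1)] xy by simp
  have "transpose_mat y * J * y = transpose_mat y * (transpose_mat x * J * x) * y"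
    using x by (simp add: isometries_def)
  also have "\<dots> = (transpose_mat y * transpose_mat x) * J * (x * y)"
    using xc y t J by (simp add: assoc_mult_mat[of _ n n _ n _ n] mult_carrier_mat[of _ n n _ n])
  also have "\<dots> = J"
    unfolding txy xy using left_mult_one_mat[OF J] right_mult_one_mat[OF J] by simp
  finally have "y \<in> isometries" using y(1) by (simp add: isometries_def)
  thus ?thesis using that xy y(2) by blast
qed

lemma mult_mat_vec_lin_comb:
  assumes x: "x \<in> carrier_mat n n" and "set xs \<subseteq> V"
  shows "x *\<^sub>v lin_comb n cs xs = lin_comb n cs (map ((*\<^sub>v) x) xs)"
  using assms(2)
proof (induction xs arbitrary: cs)
  case Nil
  have "x *\<^sub>v 0\<^sub>v n = 0\<^sub>v n" using x by (intro eq_vecI) auto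
  thus ?case by simp
next
  case (Cons v xs)
  show ?case
  proof (cases cs)
    case Nil
    have "x *\<^sub>v 0\<^sub>v n = 0\<^sub>v n" using x by (intro eq_vecI) auto
    thus ?thesis using Nil by simp
  next
    case [simp]: (Cons b bs)
    have "x *\<^sub>v (b \<cdot>\<^sub>v v + lin_comb n bs xs) = x *\<^sub>v (b \<cdot>\<^sub>v v) + x *\<^sub>v lin_comb n bs xs"
      using Cons.prems by (intro mult_add_distrib_mat_vec[OF x]) auto
    also have "x *\<^sub>v (b \<cdot>\<^sub>v v) = b \<cdot>\<^sub>v (x *\<^sub>v v)"
      using Cons.prems by (intro mult_mat_vec[OF x]) auto
    finally show ?thesis using Cons.IH[of bs] Cons.prems by simp
  qed
qed

lemma isometry_indep_gram:
  assumes x: "x \<in> isometries" and xs: "indep n xs"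
  shows "indep n (map ((*\<^sub>v) x) xs) \<and> gram (map ((*\<^sub>v) x) xs) = gram xs"
  using xs
proof (induction xs)
  case (Cons v xs)
  have xc: "x \<in> carrier_mat n n" using x by (rule isometries_carrier)
  obtain y where y: "y \<in> isometries" "y * x = 1\<^sub>m n" using isometry_inverse[OF x] by blast
  have yc: "y \<in> carrier_mat n n" using y(1) by (rule isometries_carrier)
  have v: "v \<in> V" "v \<notin> list_span n xs" and xsV: "set xs \<subseteq> V"
    using Cons.prems by (auto dest: indep_carrier)
  have yx: "y *\<^sub>v (x *\<^sub>v w) = w" if "w \<in> V" for w
    using assoc_mult_mat_vec[OF yc xc that] y(2) that by simp
  have "x *\<^sub>v v \<notin> list_span n (map ((*\<^sub>v) x) xs)"
  proof
    assume "x *\<^sub>v v \<in> list_span n (map ((*\<^sub>v) x) xs)"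
    then obtain cs where cs: "x *\<^sub>v v = lin_comb n cs (map ((*\<^sub>v) x) xs)" "length cs = length xs"
      by (auto simp: list_span_def)
    hence "x *\<^sub>v v = x *\<^sub>v lin_comb n cs xs" using mult_mat_vec_lin_comb[OF xc xsV] by simp
    hence "v = lin_comb n cs xs" using yx v(1) lin_comb_carrier[OF xsV] by metis
    thus False using v(2) cs(2) by (auto simp: list_span_def)
  qed
  moreover have "map (form (x *\<^sub>v v)) (map ((*\<^sub>v) x) xs) = map (form v) xs"
    using form_isometry[OF x v(1)] xsV by auto
  ultimately show ?case using Cons mult_mat_vec_carrier[OF xc v(1)] by simp
qed simp

lemma gram_determines_form_on_span:
  assumes xs: "set xs \<subseteq> V" and ys: "set ys \<subseteq> V" and g: "gram xs = gram ys"
  shows "form (lin_comb n cs xs) (lin_comb n ds xs) = form (lin_comb n cs ys) (lin_comb n ds ys)"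
  using gram_determines_form_lin_comb[OF xs ys g, of cs] xs ys by (simp add: form_lin_comb_right)

text \<open>
  Extend both lists to bases with the same Gram matrix and let \<open>x\<close> send one basis to the other. On
  combinations with equal coefficients the form takes equal values, so \<open>x\<close> preserves it.
\<close>

theorem witt_extension:
  assumes xs: "indep n xs" and ys: "indep n ys" and g: "gram xs = gram ys" and len: "length xs \<le> n"
  shows "\<exists>x\<in>isometries. map ((*\<^sub>v) x) xs = ys"
proof -
  obtain us ws where us: "length us = n - length xs" and ws: "length ws = n - length xs"
    and ind: "indep n (us @ xs)" "indep n (ws @ ys)" and g': "gram (us @ xs) = gram (ws @ ys)"
    using extend_to_bases[OF xs ys g, of "n - length xs"] len by auto
  have lys: "length ys = length xs" using arg_cong[OF g, of length] by simp
  define as bs where "as = us @ xs" and "bs = ws @ ys"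
  have as: "indep n as" "length as = n" "set as \<subseteq> V" and bs: "length bs = n" "set bs \<subseteq> V"
    and gab: "gram as = gram bs"
    using us ws ind g' len lys indep_carrier[OF ind(1)] indep_carrier[OF ind(2)]
    by (auto simp: as_def bs_def)
  let ?A = "mat_of_cols n as" and ?B = "mat_of_cols n bs"
  obtain C where C: "C \<in> carrier_mat n n" "?A * C = 1\<^sub>m n" "C * ?A = 1\<^sub>m n"
    using mat_of_basis_invertible[OF as(1,2)] .
  have A: "?A \<in> carrier_mat n n" and B: "?B \<in> carrier_mat n n"
    using as(2) bs(1) by (simp_all only: mat_of_cols_square)
  define x where "x = ?B * C"
  have xc: "x \<in> carrier_mat n n" using B C by (simp add: x_def)
  have x_lin: "x *\<^sub>v lin_comb n cs as = lin_comb n cs bs" if "length cs = n" for cs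
  proof -
    have c: "vec_of_list cs \<in> V" using that by (rule vec_of_list_carrier)
    have "x *\<^sub>v lin_comb n cs as = x *\<^sub>v (?A *\<^sub>v vec_of_list cs)"
      using mat_of_cols_mult_vec[OF as(3), of cs] as(2) that by simp
    also have "\<dots> = (x * ?A) *\<^sub>v vec_of_list cs" by (rule assoc_mult_mat_vec[symmetric, OF xc A c])
    also have "x * ?A = ?B"
      unfolding x_def using assoc_mult_mat[OF B C(1) A] C(3) right_mult_one_mat[OF B] by simp
    also have "?B *\<^sub>v vec_of_list cs = lin_comb n cs bs"
      using mat_of_cols_mult_vec[OF bs(2), of cs] bs(1) that by simp
    finally show ?thesis .
  qed
  have form_x: "form (x *\<^sub>v v) (x *\<^sub>v w) = form v w" if vw: "v \<in> V" "w \<in> V" for v w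
  proof -
    have "v \<in> list_span n as" "w \<in> list_span n as" using vw indep_basis_span[OF as(1,2)] by auto
    then obtain cs ds where "v = lin_comb n cs as" "w = lin_comb n ds as" "length cs = n" "length ds = n"
      unfolding list_span_def as(2) by blast
    thus ?thesis using gram_determines_form_on_span[OF as(3) bs(2) gab, of cs ds] by (simp add: x_lin)
  qed
  have tJx: "transpose_mat x * J * x \<in> carrier_mat n n" using xc J by (simp add: mult_carrier_mat[of _ n n _ n])
  have "transpose_mat x * J * x = J"
  proof (rule eq_matI)
    fix i j assume "i < dim_row J" "j < dim_col J"
    hence ij: "i < n" "j < n" using J by auto
    have entry: "M $$ (i, j) = unit_vec n i \<bullet> (M *\<^sub>v unit_vec n j)" if "M \<in> carrier_mat n n" for M :: "'a mat"
      using that ij by (simp add: row_def)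
    show "(transpose_mat x * J * x) $$ (i, j) = J $$ (i, j)"
      unfolding entry[OF tJx] entry[OF J]
      using form_x[of "unit_vec n i" "unit_vec n j"] form_mult_vec[OF xc, of "unit_vec n i" "unit_vec n j"]
      by (simp add: form_def)
  qed (simp_all only: carrier_matD[OF tJx] carrier_matD[OF J])
  hence x_iso: "x \<in> isometries" using xc by (simp add: isometries_def)
  have "map ((*\<^sub>v) x) as = bs"
  proof (rule nth_equalityI)
    fix i assume "i < length (map ((*\<^sub>v) x) as)"
    hence i: "i < n" using as(2) by simp
    have Ac: "col ?A i = as ! i" "col ?B i = bs ! i"
      using i as bs nth_mem[of i as] nth_mem[of i bs] by (auto intro!: col_mat_of_cols)
    have "x * ?A = ?B"
      unfolding x_def using assoc_mult_mat[OF B C(1) A] C(3) right_mult_one_mat[OF B] by simp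
    hence "x *\<^sub>v col ?A i = col ?B i" using col_mult2[OF xc A i] by simp
    thus "map ((*\<^sub>v) x) as ! i = bs ! i" using i as(2) by (simp add: Ac)
  qed (simp add: as(2) bs(1))
  hence "map ((*\<^sub>v) x) xs = ys" using us ws by (simp add: as_def bs_def)
  thus ?thesis using x_iso by blast
qed

definition indep_lists :: "nat \<Rightarrow> 'a vec list set" where
  "indep_lists k = {xs. length xs = k \<and> indep n xs}"

lemma indep_lists_subset: "indep_lists k \<subseteq> {xs. set xs \<subseteq> V \<and> length xs = k}"
  using indep_carrier by (auto simp: indep_lists_def)

lemma finite_indep_lists: "finite (indep_lists k)"
  by (rule finite_subset[OF indep_lists_subset]) (rule finite_lists_length_eq, simp)

lemma indep_length_le:
  fixes xs :: "'a vec list"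
  assumes xs: "indep n xs"
  shows "length xs \<le> n"
proof -
  have "card (list_span n xs) \<le> card V"
    using list_span_subset[OF vec_subspace_carrier_vec indep_carrier[OF xs]] by (rule card_mono[rotated]) simp
  hence "CARD('a) ^ length xs \<le> CARD('a) ^ n" by (simp add: card_list_span[OF xs] card_vectors)
  thus ?thesis using two_le_card_field[where 'a = 'a] by (subst (asm) power_increasing_iff) auto
qed

text \<open>
  By Witt's theorem the lists with the same Gram matrix as \<open>xs\<close> are an orbit. Each stabiliser in it is in
  bijection with a coset, the isometries that send \<open>xs\<close> to \<open>ys\<close>, and these cosets partition the group.
\<close>

lemma orbit_stabilizer_count:
  assumes xs: "xs \<in> indep_lists k"
  shows "(\<Sum>ys | ys \<in> indep_lists k \<and> gram ys = gram xs. card {x \<in> isometries. map ((*\<^sub>v) x) ys = ys})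
           = card isometries"
proof -
  let ?O = "{ys \<in> indep_lists k. gram ys = gram xs}"
  have xs': "indep n xs" "length xs = k" "set xs \<subseteq> V"
    using xs indep_carrier by (auto simp: indep_lists_def)
  have "card {x \<in> isometries. map ((*\<^sub>v) x) ys = ys} = card {x \<in> isometries. map ((*\<^sub>v) x) xs = ys}"
    if ys: "ys \<in> ?O" for ys
  proof -
    have ys': "indep n ys" "gram xs = gram ys" "set ys \<subseteq> V"
      using ys indep_carrier by (auto simp: indep_lists_def)
    obtain h where h: "h \<in> isometries" "map ((*\<^sub>v) h) xs = ys"
      using witt_extension[OF xs'(1) ys'(1,2) indep_length_le[OF xs'(1)]] by blast
    obtain h' where h': "h' \<in> isometries" "h * h' = 1\<^sub>m n" "h' * h = 1\<^sub>m n"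
      using isometry_inverse[OF h(1)] .
    note c = isometries_carrier[OF h(1)] isometries_carrier[OF h'(1)]
    have map_mult: "map ((*\<^sub>v) (x * z)) zs = map ((*\<^sub>v) x) (map ((*\<^sub>v) z) zs)"
      if "x \<in> isometries" "z \<in> isometries" "set zs \<subseteq> V" for x z zs
      using that assoc_mult_mat_vec[OF isometries_carrier[OF that(1)] isometries_carrier[OF that(2)]]
      by auto
    have map_one: "map ((*\<^sub>v) (1\<^sub>m n)) zs = zs" if "set zs \<subseteq> V" for zs :: "'a vec list"
      using that by (intro map_idI) auto
    have h'ys: "map ((*\<^sub>v) h') ys = xs"
      using map_mult[OF h'(1) h(1) xs'(3)] h(2) h'(3) map_one[OF xs'(3)] by simp
    have "bij_betw (\<lambda>x. x * h) {x \<in> isometries. map ((*\<^sub>v) x) ys = ys} {x \<in> isometries. map ((*\<^sub>v) x) xs = ys}"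
    proof (rule bij_betw_byWitness[where f' = "\<lambda>x. x * h'"])
      show "\<forall>x\<in>{x \<in> isometries. map ((*\<^sub>v) x) ys = ys}. x * h * h' = x"
        using assoc_mult_mat[OF isometries_carrier c(1) c(2)] h'(2) right_mult_one_mat[OF isometries_carrier]
        by simp
      show "\<forall>x\<in>{x \<in> isometries. map ((*\<^sub>v) x) xs = ys}. x * h' * h = x"
        using assoc_mult_mat[OF isometries_carrier c(2) c(1)] h'(3) right_mult_one_mat[OF isometries_carrier]
        by simp
      show "(\<lambda>x. x * h) ` {x \<in> isometries. map ((*\<^sub>v) x) ys = ys} \<subseteq> {x \<in> isometries. map ((*\<^sub>v) x) xs = ys}"
      proof (rule image_subsetI)
        fix x assume x: "x \<in> {x \<in> isometries. map ((*\<^sub>v) x) ys = ys}"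
        hence "map ((*\<^sub>v) (x * h)) xs = map ((*\<^sub>v) x) ys" using map_mult[OF _ h(1) xs'(3), of x] h(2) by simp
        thus "x * h \<in> {x \<in> isometries. map ((*\<^sub>v) x) xs = ys}" using x mult_isometry[OF _ h(1)] by simp
      qed
      show "(\<lambda>x. x * h') ` {x \<in> isometries. map ((*\<^sub>v) x) xs = ys} \<subseteq> {x \<in> isometries. map ((*\<^sub>v) x) ys = ys}"
      proof (rule image_subsetI)
        fix x assume x: "x \<in> {x \<in> isometries. map ((*\<^sub>v) x) xs = ys}"
        hence "map ((*\<^sub>v) (x * h')) ys = map ((*\<^sub>v) x) xs" using map_mult[OF _ h'(1) ys'(3), of x] h'ys by simp
        thus "x * h' \<in> {x \<in> isometries. map ((*\<^sub>v) x) ys = ys}" using x mult_isometry[OF _ h'(1)] by simp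
      qed
    qed
    thus ?thesis by (rule bij_betw_same_card)
  qed
  hence "(\<Sum>ys\<in>?O. card {x \<in> isometries. map ((*\<^sub>v) x) ys = ys}) =
         (\<Sum>ys\<in>?O. card {x \<in> isometries. map ((*\<^sub>v) x) xs = ys})"
    by (rule sum.cong[OF refl])
  also have "\<dots> = card isometries"
  proof -
    have "(\<lambda>x. map ((*\<^sub>v) x) xs) ` isometries \<subseteq> ?O"
      using isometry_indep_gram[OF _ xs'(1)] xs'(2) by (auto simp: indep_lists_def)
    thus ?thesis
      using sum.group[OF finite_isometries, of ?O "\<lambda>x. map ((*\<^sub>v) x) xs" "\<lambda>_. 1 :: nat"] finite_indep_lists
      by simp
  qed
  finally show ?thesis by simp
qed

theorem burnside_indep_lists:
  "(\<Sum>x\<in>isometries. card {xs \<in> indep_lists k. map ((*\<^sub>v) x) xs = xs})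
     = card isometries * card (gram ` indep_lists k)"
proof -
  have "(\<Sum>x\<in>isometries. card {xs \<in> indep_lists k. map ((*\<^sub>v) x) xs = xs})
      = (\<Sum>x\<in>isometries. \<Sum>xs\<in>indep_lists k. if map ((*\<^sub>v) x) xs = xs then 1 else 0)"
    using finite_indep_lists by (simp add: sum.If_cases Int_def)
  also have "\<dots> = (\<Sum>xs\<in>indep_lists k. \<Sum>x\<in>isometries. if map ((*\<^sub>v) x) xs = xs then 1 else 0)"
    by (rule sum.swap)
  also have "\<dots> = (\<Sum>xs\<in>indep_lists k. card {x \<in> isometries. map ((*\<^sub>v) x) xs = xs})"
    using finite_isometries by (simp add: sum.If_cases Int_def)
  also have "\<dots> = (\<Sum>A\<in>gram ` indep_lists k. \<Sum>xs | xs \<in> indep_lists k \<and> gram xs = A.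
      card {x \<in> isometries. map ((*\<^sub>v) x) xs = xs})"
    by (rule sum.image_gen[OF finite_indep_lists])
  also have "\<dots> = (\<Sum>A\<in>gram ` indep_lists k. card isometries)"
    by (rule sum.cong[OF refl]) (auto simp: orbit_stabilizer_count)
  finally show ?thesis by simp
qed

end

text \<open>
  Strictly upper triangular arrays, in the encoding used by \<open>gram\<close>.
\<close>

fun gram_shapes :: "nat \<Rightarrow> 'a list list set" where
  "gram_shapes 0 = {[]}"
| "gram_shapes (Suc k) = (\<lambda>(b, A). b # A) ` ({b. length b = k} \<times> gram_shapes k)"

lemma finite_gram_shapes: "finite (gram_shapes k :: 'a::finite list list set)"
  by (induction k) (simp_all add: finite_lists_length)

lemma card_gram_shapes: "card (gram_shapes k :: 'a::finite list list set) = CARD('a) ^ (k choose 2)"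
proof (induction k)
  case (Suc k)
  have "inj_on (\<lambda>(b, A). b # A) ({b :: 'a list. length b = k} \<times> gram_shapes k)"
    by (auto simp: inj_on_def)
  thus ?case
    by (simp add: card_image card_cartesian_product card_lists_length Suc power_add numeral_2_eq_2)
qed (simp add: numeral_2_eq_2)

context symplectic_form
begin

lemma gram_in_shapes: "gram xs \<in> gram_shapes (length xs)"
  by (induction xs) auto

lemma card_gram_image_le: "card (gram ` indep_lists k) \<le> CARD('a) ^ (k choose 2)"
proof -
  have "card (gram ` indep_lists k) \<le> card (gram_shapes k :: 'a list list set)"
    using gram_in_shapes by (intro card_mono finite_gram_shapes) (auto simp: indep_lists_def)
  thus ?thesis by (simp add: card_gram_shapes)
qed

text \<open>
  By induction every array is the Gram matrix of an independent list, since each new row can be realised by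
  \<open>extensions_nonempty\<close> as long as the list is shorter than half of the dimension.
\<close>

lemma card_gram_image_eq:
  assumes "2 * k \<le> n"
  shows "card (gram ` indep_lists k) = CARD('a) ^ (k choose 2)"
proof -
  have "\<exists>xs\<in>indep_lists k. gram xs = A" if "A \<in> gram_shapes k" "2 * k \<le> n" for A
    using that
  proof (induction k arbitrary: A)
    case (Suc k)
    then obtain b B where A: "A = b # B" "length b = k" "B \<in> gram_shapes k" by auto
    then obtain xs where xs: "indep n xs" "length xs = k" "gram xs = B"
      using Suc by (auto simp: indep_lists_def)
    then obtain v where v: "v \<in> extensions xs b"
      using extensions_nonempty[OF xs(1), of b] A(2) Suc.prems(2) by auto
    show ?case
      using indep_Cons_extension[OF xs(1) v] gram_Cons_extension[OF v] xs A
      by (intro bexI[of _ "v # xs"]) (simp_all add: indep_lists_def)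
  qed (simp add: indep_lists_def)
  hence "gram_shapes k \<subseteq> gram ` indep_lists k" using assms by blast
  moreover have "gram ` indep_lists k \<subseteq> gram_shapes k"
    using gram_in_shapes by (auto simp: indep_lists_def)
  ultimately have "gram ` indep_lists k = gram_shapes k" by (rule equalityI[rotated])
  thus ?thesis by (simp add: card_gram_shapes)
qed

end

text \<open>
  Coordinates with respect to a basis of the kernel identify it with the functions from the basis to the field.
\<close>

lemma card_mat_kernel:
  fixes A :: "'a::{finite,field} mat"
  assumes "A \<in> carrier_mat m n"
  shows "card (mat_kernel A) = CARD('a) ^ kernel_dim A"
proof -
  interpret K: kernel m n A by unfold_locales (rule assms)
  have fin: "finite (mat_kernel A)"
    by (rule finite_subset[OF mat_kernel_carrier[OF assms]]) simp
  have "K.Ker.fin_dim"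
    unfolding K.Ker.fin_dim_def
    using fin K.Ker.in_own_span[of "mat_kernel A"] K.Ker.span_closed[of "mat_kernel A"] by (intro exI[of _ "mat_kernel A"]) blast
  then obtain B where B: "finite B" "K.basis B" using K.Ker.finite_basis_exists by blast
  hence BK: "B \<subseteq> mat_kernel A" by (simp add: K.Ker.basis_def)
  have "\<exists>!a. a \<in> B \<rightarrow>\<^sub>E UNIV \<and> K.lincomb a B = v" if "v \<in> mat_kernel A" for v
    using K.Ker.basis_criterion[OF B(1) BK] B(2) that by blast
  moreover have "K.lincomb a B \<in> mat_kernel A" for a
    using K.Ker.lincomb_closed[OF BK, of a] by simp
  ultimately have "bij_betw (\<lambda>a. K.lincomb a B) (B \<rightarrow>\<^sub>E (UNIV :: 'a set)) (mat_kernel A)"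
    by (intro bij_betwI') blast+
  hence "card (B \<rightarrow>\<^sub>E (UNIV :: 'a set)) = card (mat_kernel A)" by (rule bij_betw_same_card)
  hence "card (mat_kernel A) = CARD('a) ^ card B" by (simp add: card_PiE[OF B(1)])
  thus ?thesis using K.Ker.dim_basis[OF B] by simp
qed

section \<open>The moments of the symplectic groups\<close>

lemma symplectic_form_mat_mult_vec:
  fixes a b :: "'a::field vec"
  assumes "a \<in> carrier_vec g" "b \<in> carrier_vec g"
  shows "symplectic_form_mat g *\<^sub>v (a @\<^sub>v b) = b @\<^sub>v - a"
proof -
  have "symplectic_form_mat g *\<^sub>v (a @\<^sub>v b) =
      (0\<^sub>m g g *\<^sub>v a + 1\<^sub>m g *\<^sub>v b) @\<^sub>v (- 1\<^sub>m g *\<^sub>v a + 0\<^sub>m g g *\<^sub>v b)"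
    unfolding symplectic_form_mat_def using assms by (intro four_block_mat_mult_vec) auto
  moreover have "0\<^sub>m g g *\<^sub>v c = 0\<^sub>v g" if "c \<in> carrier_vec g" for c :: "'a vec"
    using that by (intro eq_vecI) auto
  ultimately show ?thesis using assms by simp
qed

text \<open>
  Pairing with vectors supported on one half of the coordinates recovers the coordinates in the other half.
\<close>

lemma symplectic_form_symplectic_form_mat:
  "symplectic_form (2 * g) (symplectic_form_mat g :: 'a::{finite,field} mat)"
proof
  show "symplectic_form_mat g \<in> carrier_mat (2 * g) (2 * g)"
    unfolding symplectic_form_mat_def mult_2 by (intro four_block_carrier_mat) auto
next
  fix v :: "'a vec" assume "v \<in> carrier_vec (2 * g)"
  then obtain a b where ab: "a \<in> carrier_vec g" "b \<in> carrier_vec g" and v: "v = a @\<^sub>v b"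
    by (metis vec_first_last_append vec_first_carrier vec_last_carrier mult_2)
  show "v \<bullet> (symplectic_form_mat g *\<^sub>v v) = 0"
    unfolding v symplectic_form_mat_mult_vec[OF ab] using ab
    by (simp add: scalar_prod_append[of _ g _ g] comm_scalar_prod[of a g b])
  assume nd: "v \<bullet> (symplectic_form_mat g *\<^sub>v w) = 0" if "w \<in> carrier_vec (2 * g)" for w
  have prod: "a \<bullet> d - b \<bullet> c = 0" if cd: "c \<in> carrier_vec g" "d \<in> carrier_vec g" for c d
  proof -
    have "c @\<^sub>v d \<in> carrier_vec (2 * g)" using cd by (simp add: mult_2)
    hence "(a @\<^sub>v b) \<bullet> (symplectic_form_mat g *\<^sub>v (c @\<^sub>v d)) = 0" using nd by (simp add: v)
    thus ?thesis
      unfolding symplectic_form_mat_mult_vec[OF cd] using ab cd by (simp add: scalar_prod_append[of _ g _ g])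
  qed
  have "a = 0\<^sub>v g"
  proof (rule eq_vecI)
    fix i assume "i < dim_vec (0\<^sub>v g :: 'a vec)"
    thus "a $ i = 0\<^sub>v g $ i" using prod[of "0\<^sub>v g" "unit_vec g i"] ab by simp
  qed (use ab in simp)
  moreover have "b = 0\<^sub>v g"
  proof (rule eq_vecI)
    fix i assume "i < dim_vec (0\<^sub>v g :: 'a vec)"
    thus "b $ i = 0\<^sub>v g $ i" using prod[of "unit_vec g i" "0\<^sub>v g"] ab by simp
  qed (use ab in simp)
  ultimately show "v = 0\<^sub>v (2 * g)" unfolding v mult_2 by (intro eq_vecI) auto
qed

lemma mult_vec_fixed_iff_kernel:
  fixes x :: "'a::field mat"
  assumes x: "x \<in> carrier_mat n n" and v: "v \<in> carrier_vec n"
  shows "x *\<^sub>v v = v \<longleftrightarrow> v \<in> mat_kernel (x - 1\<^sub>m n)"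
proof -
  have c: "x - 1\<^sub>m n \<in> carrier_mat n n" using x by auto
  have "(x - 1\<^sub>m n) *\<^sub>v v = x *\<^sub>v v - v"
    using minus_mult_distrib_mat_vec[OF x one_carrier_mat v] v by simp
  moreover have "x *\<^sub>v v - v = 0\<^sub>v n \<longleftrightarrow> x *\<^sub>v v = v"
  proof
    assume *: "x *\<^sub>v v - v = 0\<^sub>v n"
    have xv: "x *\<^sub>v v \<in> carrier_vec n" using mult_mat_vec_carrier[OF x v] .
    show "x *\<^sub>v v = v"
    proof (rule eq_vecI)
      fix i assume "i < dim_vec v"
      hence i: "i < n" using v by simp
      have "(x *\<^sub>v v - v) $ i = 0\<^sub>v n $ i" by (simp only: *)
      thus "(x *\<^sub>v v) $ i = v $ i" using i v by simp
    qed (simp only: carrier_vecD[OF xv] carrier_vecD[OF v])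
  qed (use v in simp)
  ultimately show ?thesis using v by (simp add: mat_kernel[OF c])
qed

lemma vec_subspace_mat_kernel:
  assumes "A \<in> carrier_mat m n"
  shows "vec_subspace n (mat_kernel A)"
  unfolding vec_subspace_def mat_kernel[OF assms] using assms
  by (auto simp: mult_add_distrib_mat_vec[OF assms] mult_mat_vec[OF assms])

context symplectic_form
begin

lemma fixed_indep_lists:
  assumes x: "x \<in> carrier_mat n n"
  shows "real (card {xs \<in> indep_lists k. map ((*\<^sub>v) x) xs = xs}) =
    (\<Prod>i<k. real CARD('a) ^ kernel_dim (x - 1\<^sub>m n) - real CARD('a) ^ i)"
proof -
  have c: "x - 1\<^sub>m n \<in> carrier_mat n n" using x by auto
  let ?K = "mat_kernel (x - 1\<^sub>m n)"
  have "map ((*\<^sub>v) x) xs = xs \<longleftrightarrow> set xs \<subseteq> ?K" if "indep n xs" for xs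
    using mult_vec_fixed_iff_kernel[OF x] indep_carrier[OF that]
    by (induction xs) (simp_all only: list.map list.inject list.set insert_subset empty_subsetI simp_thms)
  hence "{xs \<in> indep_lists k. map ((*\<^sub>v) x) xs = xs} = {xs. length xs = k \<and> set xs \<subseteq> ?K \<and> indep n xs}"
    unfolding indep_lists_def by blast
  thus ?thesis
    using card_indep_lists_in_subspace[OF vec_subspace_mat_kernel[OF c] card_mat_kernel[OF c]] by simp
qed

lemma kernel_dim_le:
  assumes "A \<in> carrier_mat m n"
  shows "kernel_dim (A :: 'a mat) \<le> n"
proof -
  have "card (mat_kernel A) \<le> card V"
    by (rule card_mono[OF _ mat_kernel_carrier[OF assms]]) simp
  hence "CARD('a) ^ kernel_dim A \<le> CARD('a) ^ n" by (simp only: card_mat_kernel[OF assms] card_vectors)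
  thus ?thesis using two_le_card_field[where 'a = 'a] by (subst (asm) power_increasing_iff) auto
qed

text \<open>
  The left-hand side groups the isometries by the dimension of their fixed space. In each group the number of
  independent lists of fixed vectors is given by \<open>fixed_indep_lists\<close>, so Burnside's count applies.
\<close>

theorem injection_moments:
  "(\<Sum>r\<le>n. real (card {x \<in> isometries. kernel_dim (x - 1\<^sub>m n) = r}) / real (card isometries)
       * (\<Prod>i<k. real CARD('a) ^ r - real CARD('a) ^ i)) = real (card (gram ` indep_lists k))"
proof -
  let ?f = "\<lambda>r. \<Prod>i<k. real CARD('a) ^ r - real CARD('a) ^ i" and ?d = "\<lambda>x. kernel_dim (x - 1\<^sub>m n)"
  have pos: "real (card isometries) \<noteq> 0"
    using finite_isometries one_isometry by (auto simp: card_eq_0_iff)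
  have d: "?d ` isometries \<subseteq> {..n}"
    using kernel_dim_le[OF minus_carrier_mat[OF one_carrier_mat]] by blast
  have "(\<Sum>r\<le>n. real (card {x \<in> isometries. ?d x = r}) * ?f r) =
        (\<Sum>r\<le>n. \<Sum>x | x \<in> isometries \<and> ?d x = r. ?f (?d x))"
    by (intro sum.cong refl) simp
  also have "\<dots> = (\<Sum>x\<in>isometries. ?f (?d x))"
    by (rule sum.group[OF finite_isometries _ d]) simp
  also have "\<dots> = (\<Sum>x\<in>isometries. real (card {xs \<in> indep_lists k. map ((*\<^sub>v) x) xs = xs}))"
    by (intro sum.cong refl) (simp only: fixed_indep_lists[OF isometries_carrier])
  also have "\<dots> = real (card isometries) * real (card (gram ` indep_lists k))"
    using arg_cong[OF burnside_indep_lists[of k], of real] by simp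
  finally have eq: "(\<Sum>r\<le>n. real (card {x \<in> isometries. ?d x = r}) * ?f r) =
      real (card isometries) * real (card (gram ` indep_lists k))" .
  have "(\<Sum>r\<le>n. real (card {x \<in> isometries. ?d x = r}) / real (card isometries) * ?f r) =
      (\<Sum>r\<le>n. real (card {x \<in> isometries. ?d x = r}) * ?f r) / real (card isometries)"
    by (simp add: sum_divide_distrib)
  thus ?thesis using pos by (simp add: eq)
qed

end

lemma alpha_moments:
  obtains N where
    "(\<Sum>r\<le>2 * g. alpha TYPE('a::{finite,field}) g r * (\<Prod>i<k. real CARD('a) ^ r - real CARD('a) ^ i)) = real N"
    "N \<le> CARD('a) ^ (k choose 2)" "k \<le> g \<longrightarrow> N = CARD('a) ^ (k choose 2)"
proof -
  interpret symplectic_form "2 * g" "symplectic_form_mat g :: 'a mat"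
    by (rule symplectic_form_symplectic_form_mat)
  have "Sp g = isometries" by (simp add: Sp_def isometries_def)
  thus ?thesis
    using that[OF _ card_gram_image_le[of k]] injection_moments[of k] card_gram_image_eq[of k]
    by (simp add: alpha_def)
qed

lemma alpha_eq_0:
  assumes "2 * g < r"
  shows "alpha TYPE('a::{finite,field}) g r = 0"
proof -
  interpret symplectic_form "2 * g" "symplectic_form_mat g :: 'a mat"
    by (rule symplectic_form_symplectic_form_mat)
  have "kernel_dim (x - 1\<^sub>m (2 * g)) \<noteq> r" if "x \<in> Sp g" for x :: "'a mat"
    using kernel_dim_le[OF minus_carrier_mat[OF one_carrier_mat, of x "2 * g"]] assms by simp
  hence empty: "{x \<in> (Sp g :: 'a mat set). kernel_dim (x - 1\<^sub>m (2 * g)) = r} = {}" by blast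
  show ?thesis unfolding alpha_def empty by simp
qed

theorem proposition3p1:
  fixes q :: nat
  assumes "primepow q"
    and "CARD('a::{finite,field}) = q"
  shows "(\<forall>r. (\<lambda>g. alpha TYPE('a) g r) \<longlonglongrightarrow>
                qfac_inf q / qfac_inf (q\<^sup>2) * (1 / (real q ^ (r * (r + 1) div 2) * qfac q r)))
       \<and> (prime q \<longrightarrow>
            (\<forall>r. 0 \<le> class_group_rank_dist q 0 r) \<and> class_group_rank_dist q 0 sums 1 \<and>
            (\<forall>r. (\<lambda>g. alpha TYPE('a) g r) \<longlonglongrightarrow> class_group_rank_dist q 0 r))"
proof -
  have q2: "q \<ge> 2" using two_le_card_field[where 'a = 'a] assms(2) by simp
  define N where "N g k = (\<Sum>r\<le>2 * g. alpha TYPE('a) g r * (\<Prod>i<k. real q ^ r - real q ^ i))" for g k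
  have N: "0 \<le> N g k" "N g k \<le> real q ^ (k choose 2)" "k \<le> g \<Longrightarrow> N g k = real q ^ (k choose 2)" for g k
  proof -
    obtain M where "(\<Sum>r\<le>2 * g. alpha TYPE('a) g r * (\<Prod>i<k. real CARD('a) ^ r - real CARD('a) ^ i)) = real M"
      "M \<le> CARD('a) ^ (k choose 2)" "k \<le> g \<longrightarrow> M = CARD('a) ^ (k choose 2)"
      by (rule alpha_moments[where 'a = 'a and g = g and k = k])
    hence M: "N g k = real M" "M \<le> q ^ (k choose 2)" "k \<le> g \<longrightarrow> M = q ^ (k choose 2)"
      unfolding N_def assms(2) by simp_all
    show "0 \<le> N g k" using M(1) by simp
    show "N g k \<le> real q ^ (k choose 2)" unfolding M(1) using M(2) by (metis of_nat_le_iff of_nat_power)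
    show "k \<le> g \<Longrightarrow> N g k = real q ^ (k choose 2)" using M(1,3) by simp
  qed
  have alpha_nonneg: "0 \<le> alpha TYPE('a) g r" for g r by (simp add: alpha_def)
  have N_eq: "eventually (\<lambda>g. N g k = real q ^ (k choose 2)) sequentially" for k
    using eventually_ge_at_top[of k] by (rule eventually_mono) (rule N(3))
  have alpha_zero: "alpha TYPE('a) g r = 0" if "2 * g < r" for g r
    using that by (rule alpha_eq_0)
  note * = convergence_from_injection_moments[where p = "alpha TYPE('a)" and D = "\<lambda>g. 2 * g" and N = N,
      OF q2 alpha_nonneg alpha_zero N_def[symmetric] N(1,2) N_eq]
  have "0 \<le> class_group_rank_dist q 0 r" for r
    using *(1)[of r] by (rule LIMSEQ_le_const) (use alpha_nonneg in auto)
  moreover have "class_group_rank_dist q 0 r =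
      qfac_inf q / qfac_inf (q\<^sup>2) * (1 / (real q ^ (r * (r + 1) div 2) * qfac q r))" for r
    by (simp add: class_group_rank_dist_def)
  ultimately show ?thesis using * by simp
qed

end
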